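(* Let $u$ be an optimal solution of $\min_{v\in\mathcal U^{\mathrm{ad}}}j(v)$ and let $\{u^n\}$ be generated by the projected stochastic gradient method described in the context, with step sizes $t_n=\frac{\theta}{n+\nu}$ and with bias satisfying $K_n\le\frac{K}{n+\nu}$ for all $n$, where $K,\nu,\theta>0$. If $j$ is $\mu$-strongly convex and $\theta$ and $\nu$ are chosen such that $\theta>1/(2\mu)$ and $\nu\ge\frac{2\theta K}{2\mu\theta-1}-1$, then $$\mathbb E[\|u^n-u\|_{\mathcal U}]\le\sqrt{\frac{\rho}{n+\nu}}$$ with $$\rho:=\max\left\{(1+\nu)\,\mathbb E[\|u^1-u\|_{\mathcal U}^2],\ \frac{-(\theta^2M+2\theta K)(1+\nu)}{(1+\nu)(1-2\mu\theta)+2\theta K}\right\}.$$ If additionally $\nabla j$ is Lipschitz continuous with constant $L>0$ and $\nabla j(u)=0$, then $$\mathbb E[j(u^n)-j(u)]\le\frac{L\rho}{2(n+\nu)}.$$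
   Context: $(\mathcal U,(\cdot,\cdot)_{\mathcal U})$ is a Hilbert space with norm $\|\cdot\|_{\mathcal U}$, $\mathcal U^{\mathrm{ad}}\subset\mathcal U$ is nonempty, closed, convex and bounded, $(\Omega,\mathcal F,\mathbb P)$ is a probability space, and $\xi:\Omega\to\Xi\subset\mathbb R^m$ is a random vector. $J:\mathcal U\times\Xi\to\mathbb R$ is such that $v\mapsto J(v,\xi(\omega))$ is convex on $\mathcal U^{\mathrm{ad}}$ for almost every $\omega$, and $J$ is $L^2$-Fréchet differentiable on an open neighborhood of $\mathcal U^{\mathrm{ad}}$: $J$ is square integrable in $\omega$ and at each point $v$ of the neighborhood there is a bounded and linear random operator $A(v,\xi)$ with $\lim_{h\to0}\|J(v+h,\xi)-J(v,\xi)-A(v,\xi)h\|_{L^2(\Omega)}/\|h\|_{\mathcal U}=0$. Set $j(v)=\mathbb E[J(v,\xi)]$; then $j$ is convex on $\mathcal U^{\mathrm{ad}}$ and Fréchet differentiable with gradient $\nabla j$. Projected stochastic gradient method: given $u^1\in\mathcal U$ and $G:\mathcal U\times\Xi\to\mathcal U$ (the stochastic gradient), for $n=1,2,\dots$ generate a sample $\xi^n$ of $\xi$ independent of $\xi^1,\dots,\xi^{n-1}$, choose $t_n>0$, and set $u^{n+1}=\pi_{\mathcal U^{\mathrm{ad}}}(u^n-t_nG(u^n,\xi^n))$, where $\pi_{\mathcal U^{\mathrm{ad}}}(v)=\arg\min_{w\in\mathcal U^{\mathrm{ad}}}\|v-w\|_{\mathcal U}$ is the projection onto $\mathcal U^{\mathrm{ad}}$.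 Assumption on the stochastic gradient: $\{\mathcal F_n\}$ is an increasing sequence of sub-$\sigma$-algebras of $\mathcal F$, and with $r^n=\mathbb E[G(u^n,\xi^n)\mid\mathcal F_n]-\nabla j(u^n)$ and $w^n=G(u^n,\xi^n)-\mathbb E[G(u^n,\xi^n)\mid\mathcal F_n]$: (i) $u^n$ and $r^n$ are $\mathcal F_n$-measurable; (ii) the bias $K_n:=\operatorname{ess\,sup}_{\omega\in\Omega}\|r^n(\omega)\|_{\mathcal U}$ satisfies $\sup_nK_n<\infty$; (iii) there is a constant $M>0$ with $\mathbb E[\|G(v,\xi)\|_{\mathcal U}^2]\le M$ for all $v\in\mathcal U^{\mathrm{ad}}$. $j$ is $\mu$-strongly convex ($\mu>0$) if $j(v)\ge j(w)+(\nabla j(w),v-w)_{\mathcal U}+\frac\mu2\|v-w\|_{\mathcal U}^2$ for all $v,w\in\mathcal U^{\mathrm{ad}}$.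
   Formalization: Added, since the claim as printed fails (e.g. U^ad=[-1,1], μ=ν=1, θ=2, u^1=u=0, G=v+ξ, ξ=±1): u^1 lies in U^ad; the denominator in ρ is nonzero; and 1-2μt_n+2t_nK/(n+ν)≥0 for all n≥1. G is taken jointly measurable. *)

theory Defs
  imports "HOL-Probability.Probability"
begin

subsection \<open>Random variables and conditional expectation in a possibly non-separable Hilbert space\<close>

text \<open>The library's Bochner integral is restricted to second countable types. The notions below
  drop this restriction; the two lemmas show that on second countable types they are the library's
  notions.\<close>

definition strongly_measurable :: "'w measure \<Rightarrow> ('w \<Rightarrow> 'b::real_normed_vector) \<Rightarrow> bool" where
  "strongly_measurable M f \<longleftrightarrow>
     f \<in> borel_measurable M \<and> (\<exists>D. countable D \<and> f ` space M \<subseteq> closure D)"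

lemma strongly_measurable_second_countable:
  fixes f :: "'w \<Rightarrow> 'b::{real_normed_vector, second_countable_topology}"
  shows "strongly_measurable M f \<longleftrightarrow> f \<in> borel_measurable M"
proof -
  obtain D :: "'b set" where D: "countable D"
      "\<And>X. open X \<Longrightarrow> X \<noteq> {} \<Longrightarrow> \<exists>d\<in>D. d \<in> X"
    using countable_dense_setE by blast
  have "closure D = UNIV"
    using D(2)[of "- closure D"] closure_subset[of D] by (auto simp: open_Compl)
  then show ?thesis
    using D(1) unfolding strongly_measurable_def by blast
qed

definition has_strong_integral ::
    "'w measure \<Rightarrow> ('w \<Rightarrow> 'b::real_normed_vector) \<Rightarrow> 'b \<Rightarrow> bool" where
  "has_strong_integral M f x \<longleftrightarrow> f \<in> borel_measurable M \<and>
     (\<exists>s. (\<forall>i. Bochner_Integration.simple_bochner_integrable M (s i)) \<and>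
          (\<lambda>i. \<integral>\<^sup>+\<omega>. ennreal (norm (f \<omega> - s i \<omega>)) \<partial>M) \<longlonglongrightarrow> 0 \<and>
          (\<lambda>i. Bochner_Integration.simple_bochner_integral M (s i)) \<longlonglongrightarrow> x)"

lemma has_strong_integral_second_countable:
  fixes f :: "'w \<Rightarrow> 'b::{real_normed_vector, second_countable_topology}"
  shows "has_strong_integral M f x \<longleftrightarrow> has_bochner_integral M f x"
  unfolding has_strong_integral_def has_bochner_integral.simps by blast

text \<open>\<open>is_cond_exp P F X Y\<close>: \<open>Y\<close> is a version of the conditional expectation of \<open>X\<close> given the
  sub-sigma-algebra \<open>F\<close>. Taking \<open>A\<close> to be the whole space, it includes integrability of \<open>X\<close> and
  of \<open>Y\<close>, the latter with respect to \<open>F\<close>.\<close>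

definition is_cond_exp ::
    "'w measure \<Rightarrow> 'w measure \<Rightarrow> ('w \<Rightarrow> 'b::real_normed_vector) \<Rightarrow> ('w \<Rightarrow> 'b) \<Rightarrow> bool" where
  "is_cond_exp P F X Y \<longleftrightarrow> subalgebra P F \<and>
     (\<forall>A\<in>sets F. \<exists>I.
        has_strong_integral P (\<lambda>\<omega>. indicator A \<omega> *\<^sub>R X \<omega>) I \<and>
        has_strong_integral (restr_to_subalg P F) (\<lambda>\<omega>. indicator A \<omega> *\<^sub>R Y \<omega>) I)"


subsection \<open>Independence\<close>

text \<open>The library's \<open>indep_var\<close> for two random variables of different types.\<close>

definition indep_rv ::
    "'w measure \<Rightarrow> 'a measure \<Rightarrow> ('w \<Rightarrow> 'a) \<Rightarrow> 'b measure \<Rightarrow> ('w \<Rightarrow> 'b) \<Rightarrow> bool" where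
  "indep_rv P S X T Y \<longleftrightarrow> X \<in> measurable P S \<and> Y \<in> measurable P T \<and>
     prob_space.indep_set P {X -` A \<inter> space P | A. A \<in> sets S} {Y -` B \<inter> space P | B. B \<in> sets T}"

lemma (in prob_space) indep_rv_eq_indep_var: "indep_rv M S X T Y \<longleftrightarrow> indep_var S X T Y"
proof -
  have *: "sigma_sets (space M) {Z -` A \<inter> space M | A. A \<in> sets N}
      = {Z -` A \<inter> space M | A. A \<in> sets N}" if "Z \<in> measurable M N" for Z :: "'a \<Rightarrow> 'b" and N
    using that sets_vimage_algebra[of "space M" Z N] sets_vimage_algebra2[of Z "space M" N]
    by (auto simp: measurable_def)
  show ?thesis
    unfolding indep_rv_def indep_var_eq using *[of X S] *[of Y T] by auto
qed


subsection \<open>The optimization problem\<close>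

text \<open>\<open>\<Xi>\<close> need not be a measurable set, hence the trace sigma-algebra.\<close>

abbreviation borel_on :: "'a::topological_space set \<Rightarrow> 'a measure" where
  "borel_on \<Xi> \<equiv> restrict_space borel \<Xi>"

definition square_integrable :: "'w measure \<Rightarrow> ('w \<Rightarrow> real) \<Rightarrow> bool" where
  "square_integrable P f \<longleftrightarrow> f \<in> borel_measurable P \<and> integrable P (\<lambda>\<omega>. (f \<omega>)\<^sup>2)"

definition norm_L2 :: "'w measure \<Rightarrow> ('w \<Rightarrow> real) \<Rightarrow> real" where
  "norm_L2 P f = sqrt (\<integral>\<omega>. (f \<omega>)\<^sup>2 \<partial>P)"

text \<open>Square integrability of \<open>A (\<xi> \<omega>) h\<close> is no additional restriction: it is forced by the
  remainder being in L2 for small \<open>h\<close> together with linearity. It is listed because \<open>norm_L2\<close>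
  is a junk value on functions that are not square integrable.\<close>

definition L2_frechet_differentiable_on ::
    "'w measure \<Rightarrow> ('w \<Rightarrow> 'x) \<Rightarrow> ('u::real_normed_vector \<Rightarrow> 'x \<Rightarrow> real) \<Rightarrow> 'u set \<Rightarrow> bool" where
  "L2_frechet_differentiable_on P \<xi> J V \<longleftrightarrow>
     (\<forall>v\<in>V. square_integrable P (\<lambda>\<omega>. J v (\<xi> \<omega>))) \<and>
     (\<forall>v\<in>V. \<exists>A :: 'x \<Rightarrow> 'u \<Rightarrow> real.
        (AE \<omega> in P. bounded_linear (A (\<xi> \<omega>))) \<and>
        (\<forall>h. square_integrable P (\<lambda>\<omega>. A (\<xi> \<omega>) h)) \<and>
        ((\<lambda>h. norm_L2 P (\<lambda>\<omega>. J (v + h) (\<xi> \<omega>) - J v (\<xi> \<omega>) - A (\<xi> \<omega>) h) / norm h)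
           \<longlongrightarrow> 0) (at 0))"

definition strongly_convex_on ::
    "real \<Rightarrow> 'u::real_inner set \<Rightarrow> ('u \<Rightarrow> real) \<Rightarrow> ('u \<Rightarrow> 'u) \<Rightarrow> bool" where
  "strongly_convex_on \<mu> S j gradj \<longleftrightarrow>
     (\<forall>v\<in>S. \<forall>w\<in>S. j v \<ge> j w + inner (gradj w) (v - w) + \<mu> / 2 * (norm (v - w))\<^sup>2)"

text \<open>The library's \<open>closest_point\<close> is restricted to Heine-Borel spaces.\<close>

definition metric_proj :: "'u::real_normed_vector set \<Rightarrow> 'u \<Rightarrow> 'u" where
  "metric_proj S v = arg_min_on (\<lambda>w. norm (v - w)) S"

end

theory Submission
  imports Defs
begin

text \<open>
  Write \<open>e n\<close> for the expectation of the squared distance of the iterate \<open>u n\<close> to the minimizer,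
  and \<open>N\<close> for \<open>n + \<nu>\<close>. Since the metric projection is nonexpansive and fixes the minimizer,
  \<open>e (n + 1)\<close> is at most
  \<open>e n - 2 t E(u n - ustar, G) + t\<^sup>2 E((norm G)\<^sup>2)\<close> with \<open>t = \<theta> / N\<close>.

  The cross term is handled by conditioning. As \<open>u n\<close> is measurable with respect to \<open>F n\<close>, the
  stochastic gradient may be replaced by its conditional expectation, which is the true gradient
  plus the bias (\<open>is_cond_exp_inner\<close>). Strong convexity and the optimality of \<open>ustar\<close> bound the
  gradient part from below by \<open>\<mu>\<close> times the squared distance (\<open>strong_monotone_at_minimizer\<close>).
  The bias part is at most \<open>K / N\<close> times the distance \<open>x\<close>, and \<open>x \<le> 1 + x\<^sup>2\<close>. The
  last term is at most \<open>t\<^sup>2 M\<close>, because the new sample is independent of the current iterate: for a frozen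
  iterate the second moment is bounded by \<open>M\<close>, and Fubini integrates this bound
  (\<open>nn_integral_indep_rv_le\<close>). Altogether
  \<open>e (n + 1) \<le> e n (1 - 2 \<mu> \<theta> / N + 2 \<theta> K / N\<^sup>2) + (\<theta>\<^sup>2 M + 2 \<theta> K) / N\<^sup>2\<close>,
  and \<open>\<rho>\<close> is chosen such that \<open>\<rho> / N\<close> is a supersolution of this recursion
  (\<open>harmonic_step_recursion\<close>). The first claim is then Jensen's inequality; the second follows
  because a function with Lipschitz gradient that vanishes at \<open>ustar\<close> grows at most
  quadratically away from \<open>ustar\<close> (\<open>lipschitz_gradient_quadratic_bound\<close>).

  The measure theory needs care because the Hilbert space may be non-separable. There the Borel
  sigma-algebra of the product space can be strictly larger than the product sigma-algebra, so that
  the difference of two Borel functions can fail to be Borel. The remedy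
  is strong measurability, that is, separable range: such functions are pointwise limits of simple
  functions (\<open>strongly_measurable_approx\<close>), and for simple functions everything can be checked
  value by value. The stochastic gradient is strongly measurable only up to a null set. Hence
  the iterate \<open>u n\<close> is not literally a measurable function of the starting point and
  the first \<open>n - 1\<close> samples, but it agrees almost surely with one
  (\<open>projected_iterates_history_measurable\<close>), and this suffices for the independence argument.
\<close>

section \<open>The metric projection in a Hilbert space\<close>

text \<open>The classical existence argument: by the parallelogram law a minimizing sequence is Cauchy,
  because the midpoint of two of its members stays in the convex set and so cannot be closer than
  the infimum. Completeness replaces the compactness behind \<open>closest_point\<close>.\<close>

lemma metric_proj_is_nearest:
  fixes S :: "'u::{real_inner, complete_space} set"
  assumes S: "S \<noteq> {}" "closed S" "convex S"
  shows "metric_proj S v \<in> S" and "w \<in> S \<Longrightarrow> norm (v - metric_proj S v) \<le> norm (v - w)"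
proof -
  define q where "q = (INF w\<in>S. (norm (v - w))\<^sup>2)"
  have bdd: "bdd_below ((\<lambda>w. (norm (v - w))\<^sup>2) ` S)"
    by (rule bdd_belowI[of _ 0]) auto
  have q_le: "q \<le> (norm (v - w))\<^sup>2" if "w \<in> S" for w
    unfolding q_def using bdd that by (rule cINF_lower)
  have "\<exists>w\<in>S. (norm (v - w))\<^sup>2 < q + 1 / real (Suc n)" for n
    using cINF_less_iff[OF S(1) bdd, of "q + 1 / real (Suc n)"] by (simp add: q_def)
  then obtain x where x: "\<And>n. x n \<in> S" "\<And>n. (norm (v - x n))\<^sup>2 < q + 1 / real (Suc n)"
    by metis
  have gap: "(norm (x m - x n))\<^sup>2 \<le> 4 / real (Suc N)" if "m \<ge> N" "n \<ge> N" for m n N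
  proof -
    have mid: "(1/2) *\<^sub>R x m + (1/2) *\<^sub>R x n \<in> S"
      using S(3) x(1) by (intro convexD) auto
    have par: "(norm (x m - x n))\<^sup>2 = 2 * (norm (v - x m))\<^sup>2 + 2 * (norm (v - x n))\<^sup>2
        - 4 * (norm (v - ((1/2) *\<^sub>R x m + (1/2) *\<^sub>R x n)))\<^sup>2"
      unfolding power2_norm_eq_inner
      by (simp add: inner_diff_left inner_diff_right inner_add_left inner_add_right inner_commute)
    have "1 / real (Suc m) \<le> 1 / real (Suc N)" "1 / real (Suc n) \<le> 1 / real (Suc N)"
      using that by (auto intro!: divide_left_mono)
    then show ?thesis
      using par q_le[OF mid] x(2)[of m] x(2)[of n] by linarith
  qed
  have "Cauchy x"
  proof (rule CauchyI)
    fix e :: real assume e: "0 < e"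
    obtain N where N: "4 / e\<^sup>2 < real N" using reals_Archimedean2 by blast
    have "4 / real (Suc N) < e\<^sup>2"
    proof -
      have "4 / e\<^sup>2 < real (Suc N)" using N by simp
      then show ?thesis using e by (simp add: field_simps)
    qed
    then have "norm (x m - x n) < e" if "m \<ge> N" "n \<ge> N" for m n
      using gap[OF that] e by (rule_tac power2_less_imp_less) auto
    then show "\<exists>M. \<forall>m\<ge>M. \<forall>n\<ge>M. norm (x m - x n) < e" by blast
  qed
  then obtain p where p: "x \<longlonglongrightarrow> p" using Cauchy_convergent convergent_def by blast
  have pS: "p \<in> S" using S(2) x(1) p by (rule closed_sequentially)
  have "(norm (v - p))\<^sup>2 \<le> q + 0"
  proof (rule LIMSEQ_le[of "\<lambda>n. (norm (v - x n))\<^sup>2" _ "\<lambda>n. q + 1 / real (Suc n)"])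
    show "(\<lambda>n. (norm (v - x n))\<^sup>2) \<longlonglongrightarrow> (norm (v - p))\<^sup>2"
      using p by (intro tendsto_intros)
    show "(\<lambda>n. q + 1 / real (Suc n)) \<longlonglongrightarrow> q + 0"
      by (intro tendsto_intros LIMSEQ_Suc[OF lim_1_over_n])
  qed (use x(2) less_imp_le in blast)
  then have "norm (v - p) \<le> norm (v - w)" if "w \<in> S" for w
    using q_le[OF that] by (auto dest: order_trans intro: power2_le_imp_le)
  with pS have "is_arg_min (\<lambda>w. norm (v - w)) (\<lambda>w. w \<in> S) p"
    by (auto simp: is_arg_min_linorder)
  then have "is_arg_min (\<lambda>w. norm (v - w)) (\<lambda>w. w \<in> S) (metric_proj S v)"
    unfolding metric_proj_def arg_min_on_def arg_min_def by (rule someI)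
  then show "metric_proj S v \<in> S" and "w \<in> S \<Longrightarrow> norm (v - metric_proj S v) \<le> norm (v - w)"
    by (auto simp: is_arg_min_linorder)
qed

text \<open>If the angle at the projection were acute, moving a little from the projection
  towards \<open>w\<close> would decrease the distance to \<open>v\<close>.\<close>

lemma metric_proj_obtuse:
  fixes S :: "'u::{real_inner, complete_space} set"
  assumes S: "S \<noteq> {}" "closed S" "convex S" and w: "w \<in> S"
  shows "inner (v - metric_proj S v) (w - metric_proj S v) \<le> 0"
proof (rule ccontr)
  define p where "p = metric_proj S v"
  define c where "c = inner (v - p) (w - p)"
  assume "\<not> ?thesis"
  then have c: "c > 0" by (simp add: c_def p_def)
  then have wp: "norm (w - p) > 0" by (auto simp: c_def)
  \<comment> \<open>The length of the move: it stays on the segment and keeps the quadratic term at or below half of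
    the linear gain.\<close>
  define s where "s = min 1 (c / (norm (w - p))\<^sup>2)"
  have s: "0 < s" "s \<le> 1" "s * (norm (w - p))\<^sup>2 \<le> c"
    using c wp by (auto simp: s_def min_def field_simps)
  have "(1 - s) *\<^sub>R p + s *\<^sub>R w \<in> S"
    using metric_proj_is_nearest(1)[OF S] w s S(3) by (intro convexD) (auto simp: p_def)
  then have "norm (v - p) \<le> norm (v - ((1 - s) *\<^sub>R p + s *\<^sub>R w))"
    unfolding p_def by (rule metric_proj_is_nearest(2)[OF S])
  also have "v - ((1 - s) *\<^sub>R p + s *\<^sub>R w) = (v - p) - s *\<^sub>R (w - p)"
    by (simp add: algebra_simps)
  finally have "(norm (v - p))\<^sup>2 \<le> (norm ((v - p) - s *\<^sub>R (w - p)))\<^sup>2"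
    by (simp add: power_mono)
  also have "\<dots> = (norm (v - p))\<^sup>2 - 2 * s * c + s * (s * (norm (w - p))\<^sup>2)"
    unfolding c_def power2_norm_eq_inner
    by (simp add: inner_diff_left inner_diff_right inner_commute algebra_simps)
  also have "\<dots> \<le> (norm (v - p))\<^sup>2 - 2 * s * c + s * c"
    using s by (intro add_left_mono mult_left_mono) auto
  finally have "s * c \<le> 0" by linarith
  then show False using s(1) c by (simp add: mult_le_0_iff)
qed

text \<open>The obtuse angles at both projections, added up, bound the squared distance of
  the projections by an inner product; then Cauchy-Schwarz.\<close>

lemma metric_proj_nonexpansive:
  fixes S :: "'u::{real_inner, complete_space} set"
  assumes S: "S \<noteq> {}" "closed S" "convex S"
  shows "norm (metric_proj S v - metric_proj S w) \<le> norm (v - w)"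
proof -
  define p q where "p = metric_proj S v" and "q = metric_proj S w"
  have "inner (v - p) (q - p) \<le> 0" "inner (w - q) (p - q) \<le> 0"
    unfolding p_def q_def by (rule metric_proj_obtuse[OF S metric_proj_is_nearest(1)[OF S]])+
  then have "(norm (p - q))\<^sup>2 \<le> inner (v - w) (p - q)"
    unfolding power2_norm_eq_inner
    by (simp add: inner_diff_left inner_diff_right inner_commute)
  also have "\<dots> \<le> norm (v - w) * norm (p - q)" by (rule norm_cauchy_schwarz)
  finally have "norm (p - q) * norm (p - q) \<le> norm (v - w) * norm (p - q)"
    by (simp add: power2_eq_square)
  then show ?thesis
    unfolding p_def[symmetric] q_def[symmetric] by (cases "p = q") auto
qed

lemma metric_proj_fixes:
  fixes S :: "'u::{real_inner, complete_space} set"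
  assumes S: "S \<noteq> {}" "closed S" "convex S" and "w \<in> S"
  shows "metric_proj S w = w"
  using metric_proj_is_nearest(2)[OF S \<open>w \<in> S\<close>, of w] by simp

lemma continuous_on_metric_proj:
  fixes S :: "'u::{real_inner, complete_space} set"
  assumes S: "S \<noteq> {}" "closed S" "convex S"
  shows "continuous_on T (metric_proj S)"
proof -
  have "1-lipschitz_on T (metric_proj S)"
    by (rule lipschitz_onI) (simp_all add: dist_norm metric_proj_nonexpansive[OF S])
  then show ?thesis by (rule lipschitz_on_continuous_on)
qed

section \<open>Strongly measurable functions\<close>

text \<open>Measurability in the parameter \<open>d\<close> can be checked for each value separately because a simple
  function takes finitely many values. This is how joint measurability of non-separable quantities
  is obtained throughout.\<close>

lemma measurable_simple_param:
  assumes s: "simple_function M s" and h: "\<And>d. (\<lambda>x. h d x) \<in> measurable M N"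
  shows "(\<lambda>x. h (s x) x) \<in> measurable M N"
proof (rule measurable_compose_countable'[where I = "s ` space M"])
  show "s \<in> M \<rightarrow>\<^sub>M count_space (s ` space M)"
    using measurable_count_space_extend[OF subset_UNIV _ measurable_simple_function[OF s]] by auto
  show "countable (s ` space M)" using s by (simp add: simple_functionD(1) countable_finite)
qed (rule h)

text \<open>The point nearest to \<open>y\<close> among \<open>0, d 0, \<dots>, d (k - 1)\<close>, ties going to the earlier one. Starting
  from \<open>0\<close> keeps the approximation error at most the norm of \<open>y\<close>, which gives a dominating function
  for free.\<close>

primrec nearest_among :: "(nat \<Rightarrow> 'b::real_normed_vector) \<Rightarrow> 'b \<Rightarrow> nat \<Rightarrow> 'b" where
  "nearest_among d y 0 = 0"
| "nearest_among d y (Suc k) =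
     (if norm (y - d k) < norm (y - nearest_among d y k) then d k else nearest_among d y k)"

text \<open>Approximate \<open>f\<close> by the nearest among the first points of a countable dense set. The selection
  compares distances to fixed points only, so it is measurable even when differences of
  Borel functions are not.\<close>

lemma strongly_measurable_approx:
  fixes f :: "'w \<Rightarrow> 'b::real_normed_vector"
  assumes f: "strongly_measurable M f"
  obtains s where "\<And>i. simple_function M (s i)"
    and "\<And>x. x \<in> space M \<Longrightarrow> (\<lambda>i. s i x) \<longlonglongrightarrow> f x"
    and "\<And>i x. norm (s i x) \<le> 2 * norm (f x)"
proof -
  obtain D where D: "countable D" "f ` space M \<subseteq> closure D" and fM: "f \<in> borel_measurable M"
    using f unfolding strongly_measurable_def by blast
  define d where "d = from_nat_into (insert 0 D)"
  have ran_d: "range d = insert 0 D"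
    unfolding d_def using D(1) by (intro range_from_nat_into) auto
  define s where "s i x = nearest_among d (f x) i" for i x
  have s0: "s 0 = (\<lambda>x. 0)" and
    sS: "s (Suc k) = (\<lambda>x. if norm (f x - d k) < norm (f x - s k x) then d k else s k x)" for k
    by (simp_all add: s_def fun_eq_iff)
  have dist_meas: "(\<lambda>x. norm (f x - c)) \<in> borel_measurable M" for c
    by (rule measurable_compose[OF fM]) (intro borel_measurable_continuous_onI continuous_intros)
  have simple: "simple_function M (s i)" for i
  proof (induction i)
    case (Suc k)
    have "(\<lambda>x. norm (f x - s k x)) \<in> borel_measurable M"
      by (rule measurable_simple_param[OF Suc]) (rule dist_meas)
    then have "{x \<in> space M. norm (f x - d k) < norm (f x - s k x)} \<in> sets M"
      using dist_meas by (rule borel_measurable_less[rotated])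
    then show ?case unfolding sS using Suc by (intro simple_function_If) auto
  qed (simp add: s0)
  have step: "norm (f x - s (Suc k) x) \<le> norm (f x - s k x)"
    "norm (f x - s (Suc k) x) \<le> norm (f x - d k)" for k x
    by (auto simp: sS)
  have anti: "norm (f x - s i x) \<le> norm (f x - s k x)" if "k \<le> i" for i k x
    using that by (induction rule: dec_induct) (auto intro: order_trans[OF step(1)])
  show thesis
  proof (rule that)
    show "simple_function M (s i)" for i by (rule simple)
    show "norm (s i x) \<le> 2 * norm (f x)" for i x
      using anti[of 0 i x] norm_triangle_ineq4[of "f x" "f x - s i x"] by (simp add: s0)
    show "(\<lambda>i. s i x) \<longlonglongrightarrow> f x" if x: "x \<in> space M" for x
    proof (rule metric_LIMSEQ_I)
      fix e :: real assume e: "0 < e"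
      obtain c where c: "c \<in> D" "dist c (f x) < e"
        using D(2) x e closure_approachable by blast
      then obtain k where k: "d k = c" using ran_d by (metis UNIV_I imageE insertCI)
      have "dist (s i x) (f x) < e" if "i \<ge> Suc k" for i
        using anti[OF that, of x] step(2)[of x k] c(2) k by (simp add: dist_norm norm_minus_commute)
      then show "\<exists>N. \<forall>i\<ge>N. dist (s i x) (f x) < e" by blast
    qed
  qed
qed

lemma strongly_measurableI_approx:
  assumes s: "\<And>i. simple_function M (s i)"
    and lim: "\<And>x. x \<in> space M \<Longrightarrow> (\<lambda>i. s i x) \<longlonglongrightarrow> f x"
  shows "strongly_measurable M f"
  unfolding strongly_measurable_def
proof (intro conjI exI)
  show "f \<in> borel_measurable M"
    using s lim by (blast intro: borel_measurable_LIMSEQ_metric[of s] borel_measurable_simple_function)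
  show "countable (\<Union>i. s i ` space M)"
    using s by (auto simp: simple_functionD(1) countable_finite)
  show "f ` space M \<subseteq> closure (\<Union>i. s i ` space M)"
  proof safe
    fix x assume x: "x \<in> space M"
    show "f x \<in> closure (\<Union>i. s i ` space M)"
      unfolding closure_sequential using lim[OF x] x by (intro exI[of _ "\<lambda>i. s i x"]) auto
  qed
qed

text \<open>Pass to the limit in simple functions, for which the composition is again simple. The lemma
  serves for differences and for the projected step.\<close>

lemma strongly_measurable_compose2:
  assumes f: "strongly_measurable M f" and g: "strongly_measurable M g"
    and h: "continuous_on UNIV (\<lambda>p. h (fst p) (snd p))"
  shows "strongly_measurable M (\<lambda>x. h (f x) (g x))"
proof -
  obtain s where s: "\<And>i. simple_function M (s i)" "\<And>x. x \<in> space M \<Longrightarrow> (\<lambda>i. s i x) \<longlonglongrightarrow> f x"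
    using strongly_measurable_approx[OF f] by metis
  obtain r where r: "\<And>i. simple_function M (r i)" "\<And>x. x \<in> space M \<Longrightarrow> (\<lambda>i. r i x) \<longlonglongrightarrow> g x"
    using strongly_measurable_approx[OF g] by metis
  show ?thesis
  proof (rule strongly_measurableI_approx[of _ "\<lambda>i x. h (s i x) (r i x)"])
    show "simple_function M (\<lambda>x. h (s i x) (r i x))" for i
      using s(1) r(1) by (rule simple_function_compose2)
    show "(\<lambda>i. h (s i x) (r i x)) \<longlonglongrightarrow> h (f x) (g x)" if "x \<in> space M" for x
      using continuous_on_tendsto_compose[OF h tendsto_Pair[OF s(2) r(2)], OF that that] by simp
  qed
qed

lemma strongly_measurable_subset_sets:
  assumes f: "strongly_measurable N f" and sub: "sets N \<subseteq> sets M" "space N = space M"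
  shows "strongly_measurable M f"
proof -
  have "f \<in> borel_measurable M"
    using f sub by (auto simp: strongly_measurable_def intro!: measurableI dest: measurable_sets)
  then show ?thesis using f sub(2) by (simp add: strongly_measurable_def)
qed

lemma borel_measurable_norm_comp:
  fixes f :: "'w \<Rightarrow> 'b::real_normed_vector"
  assumes "f \<in> borel_measurable M"
  shows "(\<lambda>x. norm (f x)) \<in> borel_measurable M"
  by (rule measurable_compose[OF assms]) (intro borel_measurable_continuous_onI continuous_intros)

lemma borel_measurable_norm_diff_simple:
  fixes f :: "'w \<Rightarrow> 'b::real_normed_vector"
  assumes f: "f \<in> borel_measurable M" and s: "simple_function M s"
  shows "(\<lambda>x. norm (f x - s x)) \<in> borel_measurable M"
  by (rule measurable_simple_param[OF s], rule measurable_compose[OF f])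
    (intro borel_measurable_continuous_onI continuous_intros)

section \<open>Strong integrals and conditional expectations\<close>

lemma has_strong_integral_integrable_norm:
  fixes f :: "'w \<Rightarrow> 'b::real_normed_vector"
  assumes "has_strong_integral M f x"
  shows "integrable M (\<lambda>\<omega>. norm (f \<omega>))"
proof -
  obtain s where f: "f \<in> borel_measurable M"
    and s: "\<And>i. Bochner_Integration.simple_bochner_integrable M (s i)"
    and lim: "(\<lambda>i. \<integral>\<^sup>+\<omega>. ennreal (norm (f \<omega> - s i \<omega>)) \<partial>M) \<longlonglongrightarrow> 0"
    using assms unfolding has_strong_integral_def by blast
  have simple: "simple_function M (s i)" for i using s by (cases rule: simple_bochner_integrable.cases)
  obtain i where i: "(\<integral>\<^sup>+\<omega>. ennreal (norm (f \<omega> - s i \<omega>)) \<partial>M) < 1"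
    using order_tendstoD(2)[OF lim, of 1] by (auto simp: eventually_sequentially)
  have "integrable M (\<lambda>\<omega>. norm (s i \<omega>))"
    using simple_bochner_integrable_compose2[where p = "\<lambda>a b. norm a", OF _ s[of i] s[of i]]
    by (intro has_bochner_integral_simple_bochner_integrable[THEN integrable.intros]) auto
  then have si: "(\<integral>\<^sup>+\<omega>. ennreal (norm (s i \<omega>)) \<partial>M) < \<infinity>"
    by (simp add: integrable_iff_bounded)
  have "(\<integral>\<^sup>+\<omega>. ennreal (norm (f \<omega>)) \<partial>M)
      \<le> (\<integral>\<^sup>+\<omega>. ennreal (norm (f \<omega> - s i \<omega>)) + ennreal (norm (s i \<omega>)) \<partial>M)"
  proof (rule nn_integral_mono)
    show "ennreal (norm (f \<omega>)) \<le> ennreal (norm (f \<omega> - s i \<omega>)) + ennreal (norm (s i \<omega>))" for \<omega>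
      using norm_triangle_ineq[of "f \<omega> - s i \<omega>" "s i \<omega>"]
      by (auto simp flip: ennreal_plus intro!: ennreal_leI)
  qed
  also have "\<dots> = (\<integral>\<^sup>+\<omega>. ennreal (norm (f \<omega> - s i \<omega>)) \<partial>M) + (\<integral>\<^sup>+\<omega>. ennreal (norm (s i \<omega>)) \<partial>M)"
    using borel_measurable_norm_diff_simple[OF f simple] borel_measurable_norm_comp[OF borel_measurable_simple_function[OF simple]]
    by (intro nn_integral_add) auto
  also have "\<dots> < \<infinity>" using i si by (auto simp: less_top intro: order.strict_trans)
  finally show ?thesis
    using borel_measurable_norm_comp[OF f] by (intro integrableI_bounded) auto
qed

text \<open>The values of the approximating simple functions form a countable set, and the distance of
  \<open>f\<close> to it is dominated by each approximation error, hence has integral zero.\<close>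

lemma has_strong_integral_AE_separable:
  fixes f :: "'w \<Rightarrow> 'b::real_normed_vector"
  assumes "has_strong_integral M f x"
  shows "\<exists>D. countable D \<and> (AE \<omega> in M. f \<omega> \<in> closure D)"
proof -
  obtain s where f: "f \<in> borel_measurable M"
    and s: "\<And>i. Bochner_Integration.simple_bochner_integrable M (s i)"
    and lim: "(\<lambda>i. \<integral>\<^sup>+\<omega>. ennreal (norm (f \<omega> - s i \<omega>)) \<partial>M) \<longlonglongrightarrow> 0"
    using assms unfolding has_strong_integral_def by blast
  have simple: "simple_function M (s i)" for i using s by (cases rule: simple_bochner_integrable.cases)
  define D where "D = insert 0 (\<Union>i. s i ` space M)"
  have "countable D"
    using simple by (auto simp: D_def simple_functionD(1) countable_finite)
  have meas: "(\<lambda>\<omega>. infdist (f \<omega>) D) \<in> borel_measurable M"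
    by (rule measurable_compose[OF f]) (intro borel_measurable_continuous_onI continuous_intros)
  have "(\<integral>\<^sup>+\<omega>. ennreal (infdist (f \<omega>) D) \<partial>M) \<le> (\<integral>\<^sup>+\<omega>. ennreal (norm (f \<omega> - s i \<omega>)) \<partial>M)" for i
    using infdist_le[of "s i _" D "f _"] by (intro nn_integral_mono ennreal_leI) (auto simp: D_def dist_norm)
  then have "(\<integral>\<^sup>+\<omega>. ennreal (infdist (f \<omega>) D) \<partial>M) \<le> 0"
    using lim by (intro LIMSEQ_le_const[OF lim]) auto
  then have "AE \<omega> in M. infdist (f \<omega>) D = 0"
    using meas by (subst (asm) le_zero_eq, subst (asm) nn_integral_0_iff_AE) (auto simp: infdist_nonneg)
  then have "AE \<omega> in M. f \<omega> \<in> closure D"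
    by eventually_elim (auto simp: in_closure_iff_infdist_zero D_def)
  with \<open>countable D\<close> show ?thesis by blast
qed

text \<open>A continuous linear functional commutes with the integral; this turns vector-valued integrals
  into real-valued ones.\<close>

lemma has_strong_integral_inner:
  fixes f :: "'w \<Rightarrow> 'b::real_inner"
  assumes "has_strong_integral M f x"
  shows "has_bochner_integral M (\<lambda>\<omega>. inner v (f \<omega>)) (inner v x)"
proof -
  obtain s where f: "f \<in> borel_measurable M"
    and s: "\<And>i. Bochner_Integration.simple_bochner_integrable M (s i)"
    and lim: "(\<lambda>i. \<integral>\<^sup>+\<omega>. ennreal (norm (f \<omega> - s i \<omega>)) \<partial>M) \<longlonglongrightarrow> 0"
    and lims: "(\<lambda>i. Bochner_Integration.simple_bochner_integral M (s i)) \<longlonglongrightarrow> x"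
    using assms unfolding has_strong_integral_def by blast
  have simple: "simple_function M (s i)" for i using s by (cases rule: simple_bochner_integrable.cases)
  show ?thesis
  proof (rule has_bochner_integral.intros[where s = "\<lambda>i \<omega>. inner v (s i \<omega>)"])
    show "(\<lambda>\<omega>. inner v (f \<omega>)) \<in> borel_measurable M"
      by (rule measurable_compose[OF f]) (intro borel_measurable_continuous_onI continuous_intros)
    show "Bochner_Integration.simple_bochner_integrable M (\<lambda>\<omega>. inner v (s i \<omega>))" for i
      using simple_bochner_integrable_compose2[where p = "\<lambda>a b. inner v a", OF _ s[of i] s[of i]] by simp
    have up: "(\<lambda>i. ennreal (norm v) * (\<integral>\<^sup>+\<omega>. ennreal (norm (f \<omega> - s i \<omega>)) \<partial>M)) \<longlonglongrightarrow> ennreal (norm v) * 0"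
      using lim by (intro ennreal_tendsto_cmult) auto
    have le: "(\<integral>\<^sup>+\<omega>. ennreal (norm (inner v (f \<omega>) - inner v (s i \<omega>))) \<partial>M)
        \<le> ennreal (norm v) * (\<integral>\<^sup>+\<omega>. ennreal (norm (f \<omega> - s i \<omega>)) \<partial>M)" for i
    proof -
      have "(\<integral>\<^sup>+\<omega>. ennreal (norm (inner v (f \<omega>) - inner v (s i \<omega>))) \<partial>M)
          \<le> (\<integral>\<^sup>+\<omega>. ennreal (norm v) * ennreal (norm (f \<omega> - s i \<omega>)) \<partial>M)"
        using Cauchy_Schwarz_ineq2[of v "f _ - s i _"]
        by (intro nn_integral_mono) (auto simp: inner_diff_right simp flip: ennreal_mult intro!: ennreal_leI)
      also have "\<dots> = ennreal (norm v) * (\<integral>\<^sup>+\<omega>. ennreal (norm (f \<omega> - s i \<omega>)) \<partial>M)"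
        using borel_measurable_norm_diff_simple[OF f simple] by (intro nn_integral_cmult) auto
      finally show ?thesis .
    qed
    show "(\<lambda>i. \<integral>\<^sup>+\<omega>. ennreal (norm (inner v (f \<omega>) - inner v (s i \<omega>))) \<partial>M) \<longlonglongrightarrow> 0"
      by (rule tendsto_sandwich[OF _ _ tendsto_const up[unfolded mult_zero_right]])
        (simp_all only: le zero_le eventually_True)
    have "Bochner_Integration.simple_bochner_integral M (\<lambda>\<omega>. inner v (s i \<omega>)) = inner v (Bochner_Integration.simple_bochner_integral M (s i))" for i
      using bounded_linear.linear[OF bounded_linear_inner_right] s by (rule simple_bochner_integral_linear)
    then show "(\<lambda>i. Bochner_Integration.simple_bochner_integral M (\<lambda>\<omega>. inner v (s i \<omega>))) \<longlonglongrightarrow> inner v x"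
      using tendsto_inner[OF tendsto_const lims] by simp
  qed
qed

lemma inner_simple_limit:
  fixes Z W :: "'w \<Rightarrow> 'b::real_inner"
  assumes W: "W \<in> borel_measurable M" "integrable M (\<lambda>\<omega>. norm (W \<omega>))"
    and bound: "\<And>\<omega>. \<omega> \<in> space M \<Longrightarrow> norm (Z \<omega>) \<le> B"
    and s: "\<And>i. simple_function M (s i)" "\<And>\<omega>. \<omega> \<in> space M \<Longrightarrow> (\<lambda>i. s i \<omega>) \<longlonglongrightarrow> Z \<omega>"
      "\<And>i \<omega>. norm (s i \<omega>) \<le> 2 * norm (Z \<omega>)"
  shows "integrable M (\<lambda>\<omega>. inner (Z \<omega>) (W \<omega>))"
    and "(\<lambda>i. \<integral>\<omega>. inner (s i \<omega>) (W \<omega>) \<partial>M) \<longlonglongrightarrow> (\<integral>\<omega>. inner (Z \<omega>) (W \<omega>) \<partial>M)"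
proof -
  have sm: "(\<lambda>\<omega>. inner (s i \<omega>) (W \<omega>)) \<in> borel_measurable M" for i
    by (rule measurable_simple_param[OF s(1)], rule measurable_compose[OF W(1)])
      (intro borel_measurable_continuous_onI continuous_intros)
  have lim: "(\<lambda>i. inner (s i \<omega>) (W \<omega>)) \<longlonglongrightarrow> inner (Z \<omega>) (W \<omega>)" if "\<omega> \<in> space M" for \<omega>
    using s(2)[OF that] by (intro tendsto_intros)
  have Zm: "(\<lambda>\<omega>. inner (Z \<omega>) (W \<omega>)) \<in> borel_measurable M"
    using sm lim by (rule borel_measurable_LIMSEQ_metric)
  have dom: "norm (inner (s i \<omega>) (W \<omega>)) \<le> 2 * B * norm (W \<omega>)" if "\<omega> \<in> space M" for i \<omega>
  proof -
    have "norm (inner (s i \<omega>) (W \<omega>)) \<le> norm (s i \<omega>) * norm (W \<omega>)"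
      using Cauchy_Schwarz_ineq2 by auto
    also have "\<dots> \<le> 2 * B * norm (W \<omega>)"
      using s(3)[of i \<omega>] bound[OF that] by (intro mult_right_mono) auto
    finally show ?thesis .
  qed
  have AE_lim: "AE \<omega> in M. (\<lambda>i. inner (s i \<omega>) (W \<omega>)) \<longlonglongrightarrow> inner (Z \<omega>) (W \<omega>)"
    and AE_dom: "AE \<omega> in M. norm (inner (s i \<omega>) (W \<omega>)) \<le> 2 * B * norm (W \<omega>)" for i
    by (rule AE_I2, erule lim) (rule AE_I2, erule dom)
  have dominating: "integrable M (\<lambda>\<omega>. 2 * B * norm (W \<omega>))" using W(2) by simp
  show "integrable M (\<lambda>\<omega>. inner (Z \<omega>) (W \<omega>))"
    by (rule integrable_dominated_convergence[OF Zm sm dominating AE_lim AE_dom])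
  show "(\<lambda>i. \<integral>\<omega>. inner (s i \<omega>) (W \<omega>) \<partial>M) \<longlonglongrightarrow> (\<integral>\<omega>. inner (Z \<omega>) (W \<omega>) \<partial>M)"
    by (rule integral_dominated_convergence[OF Zm sm dominating AE_lim AE_dom])
qed

lemma integral_inner_simple:
  fixes W :: "'w \<Rightarrow> 'b::real_inner"
  assumes s: "simple_function M s"
    and int: "\<And>A d. A \<in> sets M \<Longrightarrow> integrable M (\<lambda>\<omega>. indicator A \<omega> * inner d (W \<omega>))"
  shows "(\<integral>\<omega>. inner (s \<omega>) (W \<omega>) \<partial>M)
      = (\<Sum>d\<in>s ` space M. \<integral>\<omega>. indicator (s -` {d} \<inter> space M) \<omega> * inner d (W \<omega>) \<partial>M)"
proof -
  have "(\<integral>\<omega>. inner (s \<omega>) (W \<omega>) \<partial>M)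
      = (\<integral>\<omega>. (\<Sum>d\<in>s ` space M. indicator (s -` {d} \<inter> space M) \<omega> * inner d (W \<omega>)) \<partial>M)"
  proof (rule Bochner_Integration.integral_cong[OF refl])
    fix \<omega> assume \<omega>: "\<omega> \<in> space M"
    have "(\<Sum>d\<in>s ` space M. indicator (s -` {d} \<inter> space M) \<omega> * inner d (W \<omega>))
        = (\<Sum>d\<in>s ` space M. if d = s \<omega> then inner d (W \<omega>) else 0)"
      using \<omega> by (intro sum.cong) (auto simp: indicator_def)
    also have "\<dots> = inner (s \<omega>) (W \<omega>)" using \<omega> simple_functionD(1)[OF s] by simp
    finally show "inner (s \<omega>) (W \<omega>)
      = (\<Sum>d\<in>s ` space M. indicator (s -` {d} \<inter> space M) \<omega> * inner d (W \<omega>))" ..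
  qed
  also have "\<dots> = (\<Sum>d\<in>s ` space M. \<integral>\<omega>. indicator (s -` {d} \<inter> space M) \<omega> * inner d (W \<omega>) \<partial>M)"
    using simple_functionD(2)[OF s] by (intro Bochner_Integration.integral_sum int)
  finally show ?thesis .
qed

text \<open>The definition speaks of vector-valued integrals over sets of \<open>F\<close>. What is used of it are
  norms and, through inner products with fixed vectors, real integrals over the original measure.\<close>

lemma is_cond_expD:
  fixes X Y :: "'w \<Rightarrow> 'b::real_inner"
  assumes ce: "is_cond_exp P F X Y"
  shows "subalgebra P F"
    and "X \<in> borel_measurable P" "integrable P (\<lambda>\<omega>. norm (X \<omega>))"
    and "Y \<in> borel_measurable F" "integrable P (\<lambda>\<omega>. norm (Y \<omega>))"
    and "\<exists>D. countable D \<and> (AE \<omega> in P. X \<omega> \<in> closure D)"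
    and "\<And>A v. A \<in> sets F \<Longrightarrow>
      (\<integral>\<omega>. indicator A \<omega> * inner v (X \<omega>) \<partial>P) = (\<integral>\<omega>. indicator A \<omega> * inner v (Y \<omega>) \<partial>P)"
proof -
  show sub: "subalgebra P F" using ce unfolding is_cond_exp_def by blast
  have space: "space F = space P" and restr: "space (restr_to_subalg P F) = space P"
    using sub by (auto simp: subalgebra_def space_restr_to_subalg)
  have "space P \<in> sets F" using space by (metis sets.top)
  then obtain I where
      X: "has_strong_integral P (\<lambda>\<omega>. indicator (space P) \<omega> *\<^sub>R X \<omega>) I" and
      Y: "has_strong_integral (restr_to_subalg P F) (\<lambda>\<omega>. indicator (space P) \<omega> *\<^sub>R Y \<omega>) I"
    using ce unfolding is_cond_exp_def by blast
  have "(\<lambda>\<omega>. indicator (space P) \<omega> *\<^sub>R X \<omega>) \<in> borel_measurable P"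
    using X unfolding has_strong_integral_def by blast
  then show "X \<in> borel_measurable P" by (rule measurable_cong[THEN iffD1, rotated]) simp
  show "integrable P (\<lambda>\<omega>. norm (X \<omega>))"
    using has_strong_integral_integrable_norm[OF X]
    by (rule Bochner_Integration.integrable_cong[OF refl, THEN iffD1, rotated]) simp
  obtain D where "countable D" "AE \<omega> in P. indicator (space P) \<omega> *\<^sub>R X \<omega> \<in> closure D"
    using has_strong_integral_AE_separable[OF X] by blast
  moreover from this(2) have "AE \<omega> in P. X \<omega> \<in> closure D"
    using AE_space by eventually_elim simp
  ultimately show "\<exists>D. countable D \<and> (AE \<omega> in P. X \<omega> \<in> closure D)" by blast
  have "(\<lambda>\<omega>. indicator (space P) \<omega> *\<^sub>R Y \<omega>) \<in> borel_measurable (restr_to_subalg P F)"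
    using Y unfolding has_strong_integral_def by blast
  then have "Y \<in> borel_measurable (restr_to_subalg P F)"
    by (rule measurable_cong[THEN iffD1, rotated]) (simp add: restr)
  then show Ym: "Y \<in> borel_measurable F" by (rule measurable_in_subalg'[OF sub])
  have "integrable (restr_to_subalg P F) (\<lambda>\<omega>. norm (Y \<omega>))"
    using has_strong_integral_integrable_norm[OF Y]
    by (rule Bochner_Integration.integrable_cong[OF refl, THEN iffD1, rotated]) (simp add: restr)
  then show "integrable P (\<lambda>\<omega>. norm (Y \<omega>))" by (rule integrable_from_subalg[OF sub])
  show "(\<integral>\<omega>. indicator A \<omega> * inner v (X \<omega>) \<partial>P) = (\<integral>\<omega>. indicator A \<omega> * inner v (Y \<omega>) \<partial>P)"
    if A: "A \<in> sets F" for A v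
  proof -
    obtain I where
      X: "has_strong_integral P (\<lambda>\<omega>. indicator A \<omega> *\<^sub>R X \<omega>) I" and
      Y: "has_strong_integral (restr_to_subalg P F) (\<lambda>\<omega>. indicator A \<omega> *\<^sub>R Y \<omega>) I"
      using ce A unfolding is_cond_exp_def by blast
    have "(\<lambda>\<omega>. inner v (Y \<omega>)) \<in> borel_measurable F"
      by (rule measurable_compose[OF Ym]) (intro borel_measurable_continuous_onI continuous_intros)
    then have "(\<lambda>\<omega>. indicator A \<omega> * inner v (Y \<omega>)) \<in> borel_measurable F"
      using A by measurable
    from integral_subalgebra2[OF sub this]
    have "(\<integral>\<omega>. indicator A \<omega> * inner v (Y \<omega>) \<partial>P) = inner v I"
      using has_bochner_integral_integral_eq[OF has_strong_integral_inner[OF Y, of v]] by simp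
    then show ?thesis
      using has_bochner_integral_integral_eq[OF has_strong_integral_inner[OF X, of v]] by simp
  qed
qed

text \<open>The pull-out property of the conditional expectation, tested against the whole space. For simple \<open>Z\<close>
  it is the defining identity on each level set, paired with the value taken there; for bounded \<open>Z\<close>
  it follows by dominated convergence.\<close>

lemma is_cond_exp_inner:
  fixes X Y Z :: "'w \<Rightarrow> 'b::real_inner"
  assumes ce: "is_cond_exp P F X Y" and Z: "strongly_measurable F Z"
    and bound: "\<And>\<omega>. \<omega> \<in> space P \<Longrightarrow> norm (Z \<omega>) \<le> B"
  shows "integrable P (\<lambda>\<omega>. inner (Z \<omega>) (X \<omega>))" and "integrable P (\<lambda>\<omega>. inner (Z \<omega>) (Y \<omega>))"
    and "(\<integral>\<omega>. inner (Z \<omega>) (X \<omega>) \<partial>P) = (\<integral>\<omega>. inner (Z \<omega>) (Y \<omega>) \<partial>P)"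
proof -
  note D = is_cond_expD[OF ce]
  have space: "space F = space P" and sets: "sets F \<subseteq> sets P"
    using D(1) by (auto simp: subalgebra_def)
  have Y: "Y \<in> borel_measurable P" using D(4) by (rule measurable_from_subalg[OF D(1)])
  obtain s where s: "\<And>i. simple_function F (s i)"
      "\<And>\<omega>. \<omega> \<in> space F \<Longrightarrow> (\<lambda>i. s i \<omega>) \<longlonglongrightarrow> Z \<omega>" "\<And>i \<omega>. norm (s i \<omega>) \<le> 2 * norm (Z \<omega>)"
    using strongly_measurable_approx[OF Z] by metis
  have sP: "simple_function P (s i)" for i
    using s(1)[of i] sets space unfolding simple_function_def by auto
  note limX = inner_simple_limit[OF D(2,3) bound sP s(2)[unfolded space] s(3)]
  note limY = inner_simple_limit[OF Y D(5) bound sP s(2)[unfolded space] s(3)]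
  show "integrable P (\<lambda>\<omega>. inner (Z \<omega>) (X \<omega>))" and "integrable P (\<lambda>\<omega>. inner (Z \<omega>) (Y \<omega>))"
    using limX(1) limY(1) by simp_all
  have int: "integrable P (\<lambda>\<omega>. indicator A \<omega> * inner d (W \<omega>))"
    if W: "W \<in> borel_measurable P" "integrable P (\<lambda>\<omega>. norm (W \<omega>))" and A: "A \<in> sets P"
    for A d and W :: "'w \<Rightarrow> 'b"
  proof (rule Bochner_Integration.integrable_bound[of _ "\<lambda>\<omega>. norm d * norm (W \<omega>)"])
    show "integrable P (\<lambda>\<omega>. norm d * norm (W \<omega>))" using W(2) by simp
    have "(\<lambda>\<omega>. inner d (W \<omega>)) \<in> borel_measurable P"
      by (rule measurable_compose[OF W(1)]) (intro borel_measurable_continuous_onI continuous_intros)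
    then show "(\<lambda>\<omega>. indicator A \<omega> * inner d (W \<omega>)) \<in> borel_measurable P"
      using A by measurable
    show "AE \<omega> in P. norm (indicator A \<omega> * inner d (W \<omega>)) \<le> norm (norm d * norm (W \<omega>))"
      using Cauchy_Schwarz_ineq2[of d] by (intro AE_I2) (auto simp: indicator_def)
  qed
  have "(\<integral>\<omega>. inner (s i \<omega>) (X \<omega>) \<partial>P) = (\<integral>\<omega>. inner (s i \<omega>) (Y \<omega>) \<partial>P)" for i
  proof -
    have level: "s i -` {d} \<inter> space P \<in> sets F" for d
      using simple_functionD(2)[OF s(1)] space by metis
    have "(\<integral>\<omega>. inner (s i \<omega>) (X \<omega>) \<partial>P)
        = (\<Sum>d\<in>s i ` space P. \<integral>\<omega>. indicator (s i -` {d} \<inter> space P) \<omega> * inner d (X \<omega>) \<partial>P)"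
      by (rule integral_inner_simple[OF sP], rule int[OF D(2,3)])
    also have "\<dots> = (\<Sum>d\<in>s i ` space P. \<integral>\<omega>. indicator (s i -` {d} \<inter> space P) \<omega> * inner d (Y \<omega>) \<partial>P)"
      by (intro sum.cong refl D(7) level)
    also have "\<dots> = (\<integral>\<omega>. inner (s i \<omega>) (Y \<omega>) \<partial>P)"
      by (rule integral_inner_simple[OF sP, symmetric], rule int[OF Y D(5)])
    finally show ?thesis .
  qed
  with limX(2) limY(2) show "(\<integral>\<omega>. inner (Z \<omega>) (X \<omega>) \<partial>P) = (\<integral>\<omega>. inner (Z \<omega>) (Y \<omega>) \<partial>P)"
    by (auto intro: LIMSEQ_unique)
qed

section \<open>Integrating out an independent variable\<close>

text \<open>Both measures agree on rectangles by independence, and the product measure is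
  determined by its values on rectangles.\<close>

lemma (in prob_space) indep_rv_distr_Pair:
  assumes ind: "indep_rv M S X T Y"
  shows "distr M (T \<Otimes>\<^sub>M S) (\<lambda>\<omega>. (Y \<omega>, X \<omega>)) = distr M T Y \<Otimes>\<^sub>M distr M S X"
proof -
  have X: "X \<in> measurable M S" and Y: "Y \<in> measurable M T"
    and iset: "indep_set {X -` A \<inter> space M | A. A \<in> sets S} {Y -` B \<inter> space M | B. B \<in> sets T}"
    using ind unfolding indep_rv_def by auto
  have YX: "(\<lambda>\<omega>. (Y \<omega>, X \<omega>)) \<in> measurable M (T \<Otimes>\<^sub>M S)" using X Y by (rule measurable_Pair[rotated])
  interpret DX: prob_space "distr M S X" using X by (rule prob_space_distr)
  interpret DY: prob_space "distr M T Y" using Y by (rule prob_space_distr)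
  show ?thesis
  proof (rule pair_measure_eqI[symmetric])
    show "sigma_finite_measure (distr M T Y)" "sigma_finite_measure (distr M S X)"
      by unfold_locales
    show "sets (distr M T Y \<Otimes>\<^sub>M distr M S X) = sets (distr M (T \<Otimes>\<^sub>M S) (\<lambda>\<omega>. (Y \<omega>, X \<omega>)))"
      by (simp cong: sets_pair_measure_cong)
    fix B A assume "B \<in> sets (distr M T Y)" "A \<in> sets (distr M S X)"
    then have B: "B \<in> sets T" and A: "A \<in> sets S" by auto
    have "prob ((X -` A \<inter> space M) \<inter> (Y -` B \<inter> space M))
        = prob (X -` A \<inter> space M) * prob (Y -` B \<inter> space M)"
      using A B by (intro indep_setD[OF iset]) auto
    moreover have "(\<lambda>\<omega>. (Y \<omega>, X \<omega>)) -` (B \<times> A) \<inter> space M = (X -` A \<inter> space M) \<inter> (Y -` B \<inter> space M)"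
      by auto
    ultimately show "emeasure (distr M T Y) B * emeasure (distr M S X) A
        = emeasure (distr M (T \<Otimes>\<^sub>M S) (\<lambda>\<omega>. (Y \<omega>, X \<omega>))) (B \<times> A)"
      using A B by (simp add: emeasure_distr[OF X] emeasure_distr[OF Y] emeasure_distr[OF YX]
        emeasure_eq_measure mult.commute flip: ennreal_mult)
  qed
qed

text \<open>Fubini: the joint law is a product, so an almost sure bound with the first argument frozen can
  be integrated.\<close>

lemma (in prob_space) nn_integral_indep_rv_le:
  assumes ind: "indep_rv M S X T Y" and f: "f \<in> borel_measurable (T \<Otimes>\<^sub>M S)"
    and le: "AE \<omega> in M. (\<integral>\<^sup>+\<omega>'. f (Y \<omega>, X \<omega>') \<partial>M) \<le> c"
  shows "(\<integral>\<^sup>+\<omega>. f (Y \<omega>, X \<omega>) \<partial>M) \<le> c"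
proof -
  have X: "X \<in> measurable M S" and Y: "Y \<in> measurable M T"
    using ind unfolding indep_rv_def by auto
  have YX: "(\<lambda>\<omega>. (Y \<omega>, X \<omega>)) \<in> measurable M (T \<Otimes>\<^sub>M S)" using X Y by (rule measurable_Pair[rotated])
  interpret DX: prob_space "distr M S X" using X by (rule prob_space_distr)
  have f': "f \<in> borel_measurable (distr M T Y \<Otimes>\<^sub>M distr M S X)"
    using f by (simp cong: measurable_cong_sets sets_pair_measure_cong)
  have f'': "f \<in> borel_measurable (T \<Otimes>\<^sub>M distr M S X)"
    using f by (simp cong: measurable_cong_sets sets_pair_measure_cong)
  have slice: "(\<lambda>x. f (y, x)) \<in> borel_measurable S" if "y \<in> space T" for y
    using measurable_Pair1'[OF that] f by (rule measurable_compose)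
  have "(\<integral>\<^sup>+\<omega>. f (Y \<omega>, X \<omega>) \<partial>M) = (\<integral>\<^sup>+p. f p \<partial>(distr M T Y \<Otimes>\<^sub>M distr M S X))"
    using f by (simp add: indep_rv_distr_Pair[OF ind, symmetric] nn_integral_distr[OF YX])
  also have "\<dots> = (\<integral>\<^sup>+y. \<integral>\<^sup>+x. f (y, x) \<partial>distr M S X \<partial>distr M T Y)"
    using DX.nn_integral_fst[OF f'] by simp
  also have "\<dots> = (\<integral>\<^sup>+\<omega>. \<integral>\<^sup>+x. f (Y \<omega>, x) \<partial>distr M S X \<partial>M)"
    using DX.borel_measurable_nn_integral_fst[OF f''] by (intro nn_integral_distr[OF Y]) simp
  also have "\<dots> = (\<integral>\<^sup>+\<omega>. \<integral>\<^sup>+\<omega>'. f (Y \<omega>, X \<omega>') \<partial>M \<partial>M)"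
    using measurable_space[OF Y] by (auto intro!: nn_integral_cong nn_integral_distr[OF X] simp: slice)
  also have "\<dots> \<le> (\<integral>\<^sup>+\<omega>. c \<partial>M)" using le by (rule nn_integral_mono_AE)
  also have "\<dots> = c" by (simp add: emeasure_space_1)
  finally show ?thesis .
qed

text \<open>The events described by \<open>Z\<close> are among those described by \<open>Y\<close>.\<close>

lemma (in prob_space) indep_rv_vimage_algebra:
  assumes ind: "indep_rv M S X T Y" and Z: "Z \<in> measurable (vimage_algebra (space M) Y T) N"
  shows "indep_rv M S X N Z"
proof -
  have X: "X \<in> measurable M S" and Y: "Y \<in> measurable M T"
    and iset: "indep_set {X -` A \<inter> space M | A. A \<in> sets S} {Y -` B \<inter> space M | B. B \<in> sets T}"
    using ind unfolding indep_rv_def by auto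
  have Yf: "Y \<in> space M \<rightarrow> space T" using Y by (auto simp: measurable_def)
  have pre: "\<exists>B. Z -` C \<inter> space M = Y -` B \<inter> space M \<and> B \<in> sets T" if "C \<in> sets N" for C
    using measurable_sets[OF Z that] unfolding sets_vimage_algebra2[OF Yf] by auto
  have "Z \<in> measurable M N"
  proof (rule measurableI)
    show "Z \<omega> \<in> space N" if "\<omega> \<in> space M" for \<omega> using measurable_space[OF Z] that by simp
    show "Z -` C \<inter> space M \<in> sets M" if "C \<in> sets N" for C
      using pre[OF that] measurable_sets[OF Y] by auto
  qed
  moreover have "{Z -` C \<inter> space M | C. C \<in> sets N} \<subseteq> {Y -` B \<inter> space M | B. B \<in> sets T}"
    using pre by auto
  then have "indep_set {X -` A \<inter> space M | A. A \<in> sets S} {Z -` C \<inter> space M | C. C \<in> sets N}"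
    using iset unfolding indep_sets2_eq by (meson subset_iff order_trans)
  ultimately show ?thesis using X unfolding indep_rv_def by blast
qed

section \<open>Strong convexity and Lipschitz gradients\<close>

lemma GDERIV_line:
  assumes "GDERIV j (a + s *\<^sub>R b) :> g"
  shows "((\<lambda>s. j (a + s *\<^sub>R b)) has_real_derivative inner b g) (at s)"
proof -
  have "((\<lambda>s. a + s *\<^sub>R b) has_derivative (\<lambda>h. h *\<^sub>R b)) (at s)"
    by (auto intro!: derivative_eq_intros)
  from diff_chain_at[OF this assms[unfolded gderiv_def]]
  show ?thesis by (simp add: o_def has_field_derivative_def mult.commute[of _ "inner b g"])
qed

lemma convex_line:
  assumes "convex S" "a \<in> S" "b \<in> S" "0 \<le> s" "s \<le> 1"
  shows "a + s *\<^sub>R (b - a) \<in> S"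
  using convexD_alt[OF assms] by (simp add: algebra_simps)

text \<open>Otherwise \<open>j\<close> would decrease along the segment from the minimizer to \<open>v\<close>.\<close>

lemma minimizer_variational_inequality:
  fixes j :: "'u::real_inner \<Rightarrow> real"
  assumes S: "convex S" and min: "is_arg_min j (\<lambda>v. v \<in> S) a"
    and grad: "GDERIV j a :> g" and v: "v \<in> S"
  shows "inner g (v - a) \<ge> 0"
proof (rule ccontr)
  assume neg: "\<not> ?thesis"
  have a: "a \<in> S" "\<And>w. w \<in> S \<Longrightarrow> j a \<le> j w" using min by (auto simp: is_arg_min_linorder)
  have "((\<lambda>s. j (a + s *\<^sub>R (v - a))) has_real_derivative inner (v - a) g) (at 0)"
    using grad by (intro GDERIV_line) simp
  moreover have "inner (v - a) g < 0" using neg by (simp add: inner_commute)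
  ultimately obtain d where d: "d > 0"
      "\<And>h. h > 0 \<Longrightarrow> h < d \<Longrightarrow> j (a + (0 + h) *\<^sub>R (v - a)) < j (a + 0 *\<^sub>R (v - a))"
    using DERIV_neg_dec_right by blast
  define h where "h = min 1 (d / 2)"
  have h: "0 < h" "h < d" "h \<le> 1" using d(1) by (auto simp: h_def)
  have "a + h *\<^sub>R (v - a) \<in> S" using h by (intro convex_line[OF S a(1) v]) auto
  with a(2) d(2)[OF h(1,2)] show False by fastforce
qed

text \<open>Add the strong convexity inequalities for the pairs \<open>(v, a)\<close> and \<open>(a, v)\<close>; the
  function values cancel, and the gradient at the minimizer contributes with the right sign.\<close>

lemma strong_monotone_at_minimizer:
  fixes j :: "'u::real_inner \<Rightarrow> real"
  assumes S: "convex S" and min: "is_arg_min j (\<lambda>v. v \<in> S) a"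
    and grad: "GDERIV j a :> gradj a" and sc: "strongly_convex_on \<mu> S j gradj" and v: "v \<in> S"
  shows "\<mu> * (norm (v - a))\<^sup>2 \<le> inner (v - a) (gradj v)"
proof -
  have a: "a \<in> S" using min by (auto simp: is_arg_min_linorder)
  have "j v \<ge> j a + inner (gradj a) (v - a) + \<mu> / 2 * (norm (v - a))\<^sup>2"
    "j a \<ge> j v + inner (gradj v) (a - v) + \<mu> / 2 * (norm (a - v))\<^sup>2"
    using sc a v unfolding strongly_convex_on_def by blast+
  moreover have "inner (gradj a) (v - a) \<ge> 0"
    using minimizer_variational_inequality[OF S min grad v] .
  moreover have "inner (gradj v) (a - v) = - inner (v - a) (gradj v)"
    by (simp add: inner_diff_left inner_diff_right inner_commute)
  ultimately show ?thesis by (simp add: norm_minus_commute)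
qed

text \<open>Along the segment from \<open>a\<close> to \<open>v\<close> the slope at parameter \<open>s\<close> is at most
  \<open>L s (norm (v - a))\<^sup>2\<close>. Subtracting the primitive of this bound leaves a nonincreasing function;
  compare its values at \<open>0\<close> and \<open>1\<close>.\<close>

lemma lipschitz_gradient_quadratic_bound:
  fixes j :: "'u::real_inner \<Rightarrow> real"
  assumes S: "convex S" and a: "a \<in> S" and v: "v \<in> S"
    and grad: "\<And>w. w \<in> S \<Longrightarrow> GDERIV j w :> gradj w"
    and lip: "L-lipschitz_on S gradj" and zero: "gradj a = 0"
  shows "j v - j a \<le> L / 2 * (norm (v - a))\<^sup>2"
proof -
  define b where "b = v - a"
  define \<phi> where "\<phi> s = j (a + s *\<^sub>R b) - L / 2 * (norm b)\<^sup>2 * s\<^sup>2" for s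
  have "\<phi> 0 \<ge> \<phi> 1"
  proof (rule DERIV_nonpos_imp_nonincreasing[of 0 1])
    fix s :: real assume s: "0 \<le> s" "s \<le> 1"
    define w where "w = a + s *\<^sub>R b"
    have w: "w \<in> S" unfolding w_def b_def using s by (rule convex_line[OF S a v])
    have "(\<phi> has_real_derivative inner b (gradj w) - L / 2 * (norm b)\<^sup>2 * (2 * s)) (at s)"
      unfolding \<phi>_def using GDERIV_line[of j a s b, OF grad[OF w, unfolded w_def]]
      by (auto intro!: derivative_eq_intros simp: w_def)
    moreover have "inner b (gradj w) \<le> norm b * norm (gradj w)" by (rule norm_cauchy_schwarz)
    moreover have "norm (gradj w) \<le> L * (s * norm b)"
      using lipschitz_onD[OF lip w a] s by (simp add: dist_norm zero w_def)
    then have "norm b * norm (gradj w) \<le> norm b * (L * (s * norm b))"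
      by (intro mult_left_mono) auto
    ultimately show "\<exists>y. (\<phi> has_real_derivative y) (at s) \<and> y \<le> 0"
      by (intro exI conjI) (auto simp: power2_eq_square algebra_simps)
  qed simp
  then show ?thesis by (simp add: \<phi>_def b_def)
qed

section \<open>The scalar recursion\<close>

text \<open>Induction with the hypothesis \<open>e n \<le> \<rho> / N\<close>, where \<open>N = n + \<nu>\<close>. The second entry of the maximum makes
  \<open>\<rho> (1 - 2 \<mu> \<theta> + 2 \<theta> K / N) + C\<close> nonpositive for \<open>N = 1 + \<nu>\<close>, hence for all later \<open>N\<close>; this leaves
  \<open>\<rho> (1 / N - 1 / N\<^sup>2)\<close>, which is at most \<open>\<rho> / (N + 1)\<close>. The induction hypothesis is multiplied by
  the contraction factor, which is why that factor has to be nonnegative.\<close>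

lemma harmonic_step_recursion:
  fixes e :: "nat \<Rightarrow> real"
  assumes pos: "K > 0" "\<nu> > 0" "\<theta> > 0" and C: "C \<ge> 0" and e0: "\<And>n. n \<ge> 1 \<Longrightarrow> 0 \<le> e n"
    and den: "(1 + \<nu>) * (1 - 2 * \<mu> * \<theta>) + 2 * \<theta> * K < 0"
    and \<rho>: "\<rho> = max ((1 + \<nu>) * e 1) (- C * (1 + \<nu>) / ((1 + \<nu>) * (1 - 2 * \<mu> * \<theta>) + 2 * \<theta> * K))"
    and nonneg: "\<And>n. n \<ge> 1 \<Longrightarrow> 0 \<le> 1 - 2 * \<mu> * \<theta> / (real n + \<nu>) + 2 * \<theta> * K / (real n + \<nu>)\<^sup>2"
    and recursion: "\<And>n. n \<ge> 1 \<Longrightarrow>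
      e (Suc n) \<le> e n * (1 - 2 * \<mu> * \<theta> / (real n + \<nu>) + 2 * \<theta> * K / (real n + \<nu>)\<^sup>2) + C / (real n + \<nu>)\<^sup>2"
  shows "n \<ge> 1 \<Longrightarrow> e n \<le> \<rho> / (real n + \<nu>)"
proof (induction n rule: dec_induct)
  case base
  have "(1 + \<nu>) * e 1 \<le> \<rho>" unfolding \<rho> by simp
  then show ?case using pos by (simp add: field_simps)
next
  case (step n)
  define N where "N = real n + \<nu>"
  have N: "N \<ge> 1 + \<nu>" "N > 0" using step(1) pos by (auto simp: N_def)
  have "0 \<le> (1 + \<nu>) * e 1" using e0[of 1] pos by simp
  then have \<rho>0: "0 \<le> \<rho>" unfolding \<rho> by (simp add: le_max_iff_disj)
  define D where "D = 1 - 2 * \<mu> * \<theta> + 2 * \<theta> * K / (1 + \<nu>)"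
  have D: "(1 + \<nu>) * (1 - 2 * \<mu> * \<theta>) + 2 * \<theta> * K = (1 + \<nu>) * D"
    using pos by (simp add: D_def field_simps)
  have Dneg: "D < 0" using den pos unfolding D by (simp add: mult_less_0_iff)
  have "- C * (1 + \<nu>) / ((1 + \<nu>) * D) \<le> \<rho>" unfolding \<rho> D by simp
  moreover have "- C * (1 + \<nu>) / ((1 + \<nu>) * D) = - C / D" using pos by simp
  ultimately have "- C / D \<le> \<rho>" by (simp only:)
  then have CD: "\<rho> * D + C \<le> 0" unfolding neg_divide_le_eq[OF Dneg] by linarith
  have "2 * \<theta> * K / N \<le> 2 * \<theta> * K / (1 + \<nu>)"
    using N pos by (intro divide_left_mono) auto
  then have "\<rho> * (1 - 2 * \<mu> * \<theta> + 2 * \<theta> * K / N) \<le> \<rho> * D"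
    using \<rho>0 by (intro mult_left_mono) (auto simp: D_def)
  with CD have key: "\<rho> * (1 - 2 * \<mu> * \<theta> + 2 * \<theta> * K / N) + C \<le> 0" by linarith
  have "e (Suc n) \<le> e n * (1 - 2 * \<mu> * \<theta> / N + 2 * \<theta> * K / N\<^sup>2) + C / N\<^sup>2"
    using recursion[OF step(1)] by (simp add: N_def)
  also have "\<dots> \<le> \<rho> / N * (1 - 2 * \<mu> * \<theta> / N + 2 * \<theta> * K / N\<^sup>2) + C / N\<^sup>2"
    using step.IH nonneg[OF step(1)] by (intro add_right_mono mult_right_mono) (auto simp: N_def)
  also have "\<dots> = \<rho> * (1 / N - 1 / N\<^sup>2) + (\<rho> * (1 - 2 * \<mu> * \<theta> + 2 * \<theta> * K / N) + C) / N\<^sup>2"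
    using N(2) by (simp add: field_simps power2_eq_square)
  also have "\<dots> \<le> \<rho> * (1 / N - 1 / N\<^sup>2) + 0"
    using key by (intro add_left_mono) (simp add: divide_le_0_iff)
  also have "\<dots> \<le> \<rho> * (1 / (N + 1)) + 0"
    using \<rho>0 N(2) by (intro add_right_mono mult_left_mono) (auto simp: field_simps power2_eq_square)
  finally show ?case by (simp add: N_def add.commute add.left_commute)
qed

section \<open>The projected stochastic gradient method\<close>

text \<open>Induction on \<open>n\<close>. Composing \<open>G\<close> with the current version of the iterate and the new sample is
  measurable with respect to the history, but subtracting the result from the iterate requires separable range.
  So the value of \<open>G\<close> is set to \<open>0\<close> outside the closure of a countable set that carries it
  almost surely, and the step is performed with this modification.\<close>

lemma (in prob_space) projected_iterates_history_measurable:
  fixes u :: "nat \<Rightarrow> 'a \<Rightarrow> 'u::{real_inner, complete_space}" and X :: "nat \<Rightarrow> 'a \<Rightarrow> 'x"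
    and S :: "'x measure" and G :: "'u \<Rightarrow> 'x \<Rightarrow> 'u"
  defines "N \<equiv> \<lambda>n. (borel :: 'u measure) \<Otimes>\<^sub>M (\<Pi>\<^sub>M i\<in>{1..<n}. S)"
    and "Z \<equiv> \<lambda>n \<omega>. (u 1 \<omega>, \<lambda>i\<in>{1..<n}. X i \<omega>)"
  assumes C: "C \<noteq> {}" "closed C" "convex C"
    and G: "(\<lambda>(v, x). G v x) \<in> borel_measurable (borel \<Otimes>\<^sub>M S)"
    and X: "\<And>n. n \<ge> 1 \<Longrightarrow> X n \<in> measurable M S"
    and u1: "strongly_measurable M (u 1)"
    and iteration: "\<And>n \<omega>. n \<ge> 1 \<Longrightarrow> \<omega> \<in> space M \<Longrightarrow>
      u (Suc n) \<omega> = metric_proj C (u n \<omega> - t n *\<^sub>R G (u n \<omega>) (X n \<omega>))"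
    and separable: "\<And>n. n \<ge> 1 \<Longrightarrow> \<exists>D. countable D \<and> (AE \<omega> in M. G (u n \<omega>) (X n \<omega>) \<in> closure D)"
  shows "n \<ge> 1 \<Longrightarrow> \<exists>v. strongly_measurable (vimage_algebra (space M) (Z n) (N n)) v \<and>
      (AE \<omega> in M. v \<omega> = u n \<omega>)"
proof -
  define H where "H n = vimage_algebra (space M) (Z n) (N n)" for n
  have space_H: "space (H n) = space M" for n by (simp add: H_def)
  have "Z n \<in> measurable M (N n)" for n
    unfolding Z_def N_def using u1 X
    by (intro measurable_Pair measurable_restrict) (auto simp: strongly_measurable_def)
  then have ZH: "Z n \<in> measurable (H n) (N n)" for n
    unfolding H_def by (intro measurable_vimage_algebra1) (auto simp: measurable_def)
  have u1H: "u 1 \<in> measurable (H n) borel" for n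
    using measurable_compose[OF ZH[of n, unfolded N_def] measurable_fst]
    by (simp add: Z_def N_def)
  have XH: "X i \<in> measurable (H n) S" if "1 \<le> i" "i < n" for i n
  proof -
    have i: "i \<in> {1..<n}" using that by simp
    have "(\<lambda>\<omega>. snd (Z n \<omega>) i) \<in> measurable (H n) S"
      using measurable_compose[OF measurable_compose[OF ZH[of n, unfolded N_def] measurable_snd]
          measurable_component_singleton[OF i]] .
    then show ?thesis using that by (simp add: Z_def)
  qed
  have HS: "sets (H n) \<subseteq> sets (H (Suc n))" for n
  proof -
    have "Z n \<in> measurable (H (Suc n)) (N n)"
      unfolding Z_def N_def by (intro measurable_Pair measurable_restrict u1H[of "Suc n"] XH) auto
    then have id: "(\<lambda>\<omega>. \<omega>) \<in> measurable (H (Suc n)) (H n)"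
      unfolding H_def[of n] by (intro measurable_vimage_algebra2) (auto simp: space_H)
    show ?thesis
    proof
      fix A assume A: "A \<in> sets (H n)"
      then have "A \<subseteq> space (H (Suc n))" using sets.sets_into_space[OF A] by (simp add: space_H)
      then show "A \<in> sets (H (Suc n))" using measurable_sets[OF id A] by (simp add: Int_absorb2)
    qed
  qed
  have "\<exists>v. strongly_measurable (H n) v \<and> (AE \<omega> in M. v \<omega> = u n \<omega>)" if "n \<ge> 1"
    using that
  proof (induction n rule: dec_induct)
    case base
    have "strongly_measurable (H 1) (u 1)"
      using u1 u1H[of 1] by (auto simp: strongly_measurable_def space_H)
    then show ?case by auto
  next
    case (step n)
    then obtain v where v: "strongly_measurable (H n) v" and v_eq: "AE \<omega> in M. v \<omega> = u n \<omega>"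
      by blast
    obtain D where D: "countable D" and G_D: "AE \<omega> in M. G (u n \<omega>) (X n \<omega>) \<in> closure D"
      using separable[OF step(1)] by blast
    define w where "w \<omega> = G (v \<omega>) (X n \<omega>)" for \<omega>
    define g where "g \<omega> = (if w \<omega> \<in> closure D then w \<omega> else 0)" for \<omega>
    have v': "strongly_measurable (H (Suc n)) v"
      by (rule strongly_measurable_subset_sets[OF v HS]) (simp add: space_H)
    have wm: "w \<in> borel_measurable (H (Suc n))"
      using measurable_compose[OF measurable_Pair[OF _ XH[OF step(1)]] G, of v "Suc n"] v'
      by (simp add: w_def[abs_def] strongly_measurable_def)
    have "g \<in> borel_measurable (H (Suc n))"
      unfolding g_def using wm measurable_sets[OF wm, of "closure D"]
      by (intro measurable_If) (auto simp: vimage_def Int_def conj_commute)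
    moreover have "g ` space M \<subseteq> closure (insert 0 D)"
      using closure_mono[of D "insert 0 D"] closure_subset[of "insert 0 D"] by (auto simp: g_def)
    ultimately have g: "strongly_measurable (H (Suc n)) g"
      using D by (auto simp: strongly_measurable_def space_H intro!: exI[of _ "insert 0 D"])
    have "strongly_measurable (H (Suc n)) (\<lambda>\<omega>. metric_proj C (v \<omega> - t n *\<^sub>R g \<omega>))"
      by (rule strongly_measurable_compose2[OF v' g],
          rule continuous_on_compose2[OF continuous_on_metric_proj[OF C, of UNIV]])
        (auto intro!: continuous_intros)
    moreover have "AE \<omega> in M. metric_proj C (v \<omega> - t n *\<^sub>R g \<omega>) = u (Suc n) \<omega>"
      using v_eq G_D AE_space
      by eventually_elim (auto simp: g_def w_def iteration[OF step(1)])
    ultimately show ?case by blast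
  qed
  then show "n \<ge> 1 \<Longrightarrow> \<exists>v. strongly_measurable (vimage_algebra (space M) (Z n) (N n)) v \<and>
      (AE \<omega> in M. v \<omega> = u n \<omega>)"
    unfolding H_def .
qed

theorem theorem3p2:
  fixes P :: "'w measure"
    and Uad V :: "'u::{real_inner, complete_space} set"
    and \<Xi> :: "(real ^ 'm) set"
    and \<xi> :: "'w \<Rightarrow> real ^ 'm"
    and J :: "'u \<Rightarrow> real ^ 'm \<Rightarrow> real"
    and gradj :: "'u \<Rightarrow> 'u"
    and G :: "'u \<Rightarrow> real ^ 'm \<Rightarrow> 'u"
    and \<xi>s :: "nat \<Rightarrow> 'w \<Rightarrow> real ^ 'm"
    and u :: "nat \<Rightarrow> 'w \<Rightarrow> 'u"
    and F :: "nat \<Rightarrow> 'w measure"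
    and EG :: "nat \<Rightarrow> 'w \<Rightarrow> 'u"
    and t :: "nat \<Rightarrow> real"
    and ustar :: 'u
    and M K \<nu> \<theta> \<mu> :: real
  defines "j \<equiv> \<lambda>v. \<integral>\<omega>. J v (\<xi> \<omega>) \<partial>P"
    and "r \<equiv> \<lambda>n \<omega>. EG n \<omega> - gradj (u n \<omega>)"
  defines "bias \<equiv> \<lambda>n. esssup P (\<lambda>\<omega>. ereal (norm (r n \<omega>)))"
    and "\<rho> \<equiv> max ((1 + \<nu>) * (\<integral>\<omega>. (norm (u 1 \<omega> - ustar))\<^sup>2 \<partial>P))
                 (- (\<theta>\<^sup>2 * M + 2 * \<theta> * K) * (1 + \<nu>)
                    / ((1 + \<nu>) * (1 - 2 * \<mu> * \<theta>) + 2 * \<theta> * K))"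
  assumes prob: "prob_space P"
    and Uad: "Uad \<noteq> {}" "closed Uad" "convex Uad" "bounded Uad"
    and xi: "\<xi> \<in> measurable P (borel_on \<Xi>)"
    and J_convex: "AE \<omega> in P. convex_on Uad (\<lambda>v. J v (\<xi> \<omega>))"
    and V: "open V" "Uad \<subseteq> V"
    and J_diff: "L2_frechet_differentiable_on P \<xi> J V"
    and gradj: "\<And>v. v \<in> V \<Longrightarrow> GDERIV j v :> gradj v"
    and G_meas: "(\<lambda>(v, x). G v x) \<in> borel_measurable (borel \<Otimes>\<^sub>M borel_on \<Xi>)"
    and samples: "\<And>n. n \<ge> 1 \<Longrightarrow> \<xi>s n \<in> measurable P (borel_on \<Xi>)"
    and samples_distr:
      "\<And>n. n \<ge> 1 \<Longrightarrow> distr P (borel_on \<Xi>) (\<xi>s n) = distr P (borel_on \<Xi>) \<xi>"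
    and samples_indep:
      "\<And>n. n \<ge> 1 \<Longrightarrow> indep_rv P
          (borel_on \<Xi>) (\<xi>s n)
          (borel \<Otimes>\<^sub>M (\<Pi>\<^sub>M i\<in>{1..<n}. borel_on \<Xi>)) (\<lambda>\<omega>. (u 1 \<omega>, \<lambda>i\<in>{1..<n}. \<xi>s i \<omega>))"
    and u1: "\<And>\<omega>. \<omega> \<in> space P \<Longrightarrow> u 1 \<omega> \<in> Uad"
    and iteration: "\<And>n \<omega>. n \<ge> 1 \<Longrightarrow> \<omega> \<in> space P \<Longrightarrow>
          u (Suc n) \<omega> = metric_proj Uad (u n \<omega> - t n *\<^sub>R G (u n \<omega>) (\<xi>s n \<omega>))"
    and F_sub: "\<And>n. n \<ge> 1 \<Longrightarrow> subalgebra P (F n)"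
    and F_mono: "\<And>m n. 1 \<le> m \<Longrightarrow> m \<le> n \<Longrightarrow> sets (F m) \<subseteq> sets (F n)"
    and EG: "\<And>n. n \<ge> 1 \<Longrightarrow> is_cond_exp P (F n) (\<lambda>\<omega>. G (u n \<omega>) (\<xi>s n \<omega>)) (EG n)"
    and u_adapted: "\<And>n. n \<ge> 1 \<Longrightarrow> strongly_measurable (F n) (u n)"
    and r_adapted: "\<And>n. n \<ge> 1 \<Longrightarrow> strongly_measurable (F n) (r n)"
    and bias_bounded: "(SUP n\<in>{1..}. bias n) < \<infinity>"
    and M_pos: "M > 0"
    and G_second_moment: "\<And>v. v \<in> Uad \<Longrightarrow>
          integrable P (\<lambda>\<omega>. (norm (G v (\<xi> \<omega>)))\<^sup>2) \<and> (\<integral>\<omega>. (norm (G v (\<xi> \<omega>)))\<^sup>2 \<partial>P) \<le> M"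
    and ustar: "is_arg_min j (\<lambda>v. v \<in> Uad) ustar"
    and pos: "K > 0" "\<nu> > 0" "\<theta> > 0" "\<mu> > 0"
    and t: "\<And>n. n \<ge> 1 \<Longrightarrow> t n = \<theta> / (real n + \<nu>)"
    and bias_decay: "\<And>n. n \<ge> 1 \<Longrightarrow> bias n \<le> ereal (K / (real n + \<nu>))"
    and strong_convexity: "strongly_convex_on \<mu> Uad j gradj"
    and theta: "\<theta> > 1 / (2 * \<mu>)"
    and nu: "\<nu> \<ge> 2 * \<theta> * K / (2 * \<mu> * \<theta> - 1) - 1"
    and denominator: "(1 + \<nu>) * (1 - 2 * \<mu> * \<theta>) + 2 * \<theta> * K \<noteq> 0"
    and factor_nonneg: "\<And>n. n \<ge> 1 \<Longrightarrow> 0 \<le> 1 - 2 * \<mu> * t n + 2 * t n * (K / (real n + \<nu>))"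
  shows "(\<forall>n\<ge>1. integrable P (\<lambda>\<omega>. norm (u n \<omega> - ustar)) \<and>
                (\<integral>\<omega>. norm (u n \<omega> - ustar) \<partial>P) \<le> sqrt (\<rho> / (real n + \<nu>)))
       \<and> (\<forall>L>0. L-lipschitz_on Uad gradj \<and> gradj ustar = 0 \<longrightarrow>
            (\<forall>n\<ge>1. integrable P (\<lambda>\<omega>. j (u n \<omega>) - j ustar) \<and>
                   (\<integral>\<omega>. (j (u n \<omega>) - j ustar) \<partial>P) \<le> L * \<rho> / (2 * (real n + \<nu>))))"
proof -
  interpret prob_space P by (rule prob)
  note proj = Uad(1-3)
  have u_Uad: "u n \<omega> \<in> Uad" if "n \<ge> 1" "\<omega> \<in> space P" for n \<omega>
    using that(1)
  proof (cases n rule: nat.exhaust)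
    case (Suc m)
    then show ?thesis
      using u1[OF that(2)] iteration[of m, OF _ that(2)] metric_proj_is_nearest(1)[OF proj]
      by (cases "m = 0") auto
  qed simp
  have ustar_Uad: "ustar \<in> Uad" using ustar by (simp add: is_arg_min_linorder)
  obtain B where B: "\<And>v. v \<in> Uad \<Longrightarrow> norm (v - ustar) \<le> B"
    using Uad(4) bounded_any_center[of Uad ustar] by (auto simp: dist_norm norm_minus_commute)
  define X where "X n \<omega> = G (u n \<omega>) (\<xi>s n \<omega>)" for n \<omega>
  define d where "d n \<omega> = u n \<omega> - ustar" for n \<omega>
  define e where "e n = (\<integral>\<omega>. (norm (d n \<omega>))\<^sup>2 \<partial>P)" for n
  note ce = EG[folded X_def]
  have F_space: "space (F n) = space P" "sets (F n) \<subseteq> sets P" if "n \<ge> 1" for n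
    using F_sub[OF that] by (auto simp: subalgebra_def)
  have u_strong: "strongly_measurable P (u n)" if "n \<ge> 1" for n
    using strongly_measurable_subset_sets[OF u_adapted F_space(2,1)] that by blast
  have d_bound: "norm (d n \<omega>) \<le> B" if "n \<ge> 1" "\<omega> \<in> space P" for n \<omega>
    using B[OF u_Uad[OF that]] by (simp add: d_def)
  have d_adapted: "strongly_measurable (F n) (d n)" if "n \<ge> 1" for n
    unfolding d_def
    by (rule strongly_measurable_compose2[OF u_adapted[OF that] u_adapted[OF that], where h = "\<lambda>a b. a - ustar"])
      (intro continuous_intros)
  have norm_d_meas: "(\<lambda>\<omega>. norm (d n \<omega>)) \<in> borel_measurable P" if "n \<ge> 1" for n
    unfolding d_def using u_strong[OF that]
    by (intro measurable_compose[of "u n" P borel "\<lambda>v. norm (v - ustar)"] borel_measurable_continuous_onI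
        continuous_intros) (simp add: strongly_measurable_def)
  have d_int: "integrable P (\<lambda>\<omega>. norm (d n \<omega>))" "integrable P (\<lambda>\<omega>. (norm (d n \<omega>))\<^sup>2)"
    if n: "n \<ge> 1" for n
  proof -
    show "integrable P (\<lambda>\<omega>. norm (d n \<omega>))"
      using d_bound[OF n] norm_d_meas[OF n] by (intro integrable_const_bound[of _ B]) auto
    show "integrable P (\<lambda>\<omega>. (norm (d n \<omega>))\<^sup>2)"
      using d_bound[OF n] norm_d_meas[OF n]
      by (intro integrable_const_bound[of _ "B\<^sup>2"]) (auto intro!: power_mono)
  qed

  \<comment> \<open>The second moment at the random iterate: \<open>f\<close> is integrated against the law of the new sample
    with the iterate frozen at a feasible point \<open>y\<close>, where the bound \<open>M\<close> is available.\<close>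
  have X_second_moment: "integrable P (\<lambda>\<omega>. (norm (X n \<omega>))\<^sup>2)" "(\<integral>\<omega>. (norm (X n \<omega>))\<^sup>2 \<partial>P) \<le> M"
    if n: "n \<ge> 1" for n
  proof -
    define f where "f = (\<lambda>p. ennreal ((norm ((\<lambda>(v, x). G v x) p))\<^sup>2))"
    have f: "f \<in> borel_measurable (borel \<Otimes>\<^sub>M borel_on \<Xi>)"
      unfolding f_def using borel_measurable_norm_comp[OF G_meas] by measurable
    have "\<exists>D. countable D \<and> (AE \<omega> in P. G (u m \<omega>) (\<xi>s m \<omega>) \<in> closure D)" if "m \<ge> 1" for m
      using is_cond_expD(6)[OF EG[OF that]] .
    from projected_iterates_history_measurable[OF proj G_meas samples u_strong[OF order.refl] iteration this n]
    obtain v where v: "strongly_measurable (vimage_algebra (space P) (\<lambda>\<omega>. (u 1 \<omega>, \<lambda>i\<in>{1..<n}. \<xi>s i \<omega>))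
          (borel \<Otimes>\<^sub>M (\<Pi>\<^sub>M i\<in>{1..<n}. borel_on \<Xi>))) v" and v_eq: "AE \<omega> in P. v \<omega> = u n \<omega>"
      by blast
    have frozen_le: "(\<integral>\<^sup>+\<omega>'. f (y, \<xi>s n \<omega>') \<partial>P) \<le> ennreal M" if y: "y \<in> Uad" for y
    proof -
      have fy: "(\<lambda>x. f (y, x)) \<in> borel_measurable (borel_on \<Xi>)"
        using measurable_Pair1'[of y borel "borel_on \<Xi>"] f by (auto intro: measurable_compose)
      have "(\<integral>\<^sup>+\<omega>'. f (y, \<xi>s n \<omega>') \<partial>P) = (\<integral>\<^sup>+\<omega>'. f (y, \<xi> \<omega>') \<partial>P)"
        using nn_integral_distr[OF samples[OF n], of "\<lambda>x. f (y, x)"] nn_integral_distr[OF xi, of "\<lambda>x. f (y, x)"]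
          fy samples_distr[OF n] by simp
      also have "\<dots> = ennreal (\<integral>\<omega>. (norm (G y (\<xi> \<omega>)))\<^sup>2 \<partial>P)"
        unfolding f_def using G_second_moment[OF y] by (simp add: nn_integral_eq_integral)
      also have "\<dots> \<le> ennreal M" using G_second_moment[OF y] by (intro ennreal_leI) blast
      finally show ?thesis .
    qed
    have "AE \<omega> in P. (\<integral>\<^sup>+\<omega>'. f (v \<omega>, \<xi>s n \<omega>') \<partial>P) \<le> ennreal M"
      using v_eq AE_space by eventually_elim (simp add: frozen_le u_Uad[OF n])
    from nn_integral_indep_rv_le[OF indep_rv_vimage_algebra[OF samples_indep[OF n]] f this]
    have "(\<integral>\<^sup>+\<omega>. f (v \<omega>, \<xi>s n \<omega>) \<partial>P) \<le> ennreal M"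
      using v by (simp add: strongly_measurable_def)
    moreover have "(\<integral>\<^sup>+\<omega>. f (v \<omega>, \<xi>s n \<omega>) \<partial>P) = (\<integral>\<^sup>+\<omega>. ennreal ((norm (X n \<omega>))\<^sup>2) \<partial>P)"
      using v_eq by (intro nn_integral_cong_AE) (auto simp: f_def X_def)
    ultimately have le: "(\<integral>\<^sup>+\<omega>. ennreal ((norm (X n \<omega>))\<^sup>2) \<partial>P) \<le> ennreal M" by simp
    have Xm: "(\<lambda>\<omega>. (norm (X n \<omega>))\<^sup>2) \<in> borel_measurable P"
      using borel_measurable_norm_comp[OF is_cond_expD(2)[OF ce[OF n]]] by measurable
    show int: "integrable P (\<lambda>\<omega>. (norm (X n \<omega>))\<^sup>2)"
      using le Xm by (intro integrableI_bounded) (auto intro: le_less_trans)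
    show "(\<integral>\<omega>. (norm (X n \<omega>))\<^sup>2 \<partial>P) \<le> M"
      using le M_pos unfolding nn_integral_eq_integral[OF int AE_I2, simplified]
      by (simp add: ennreal_le_iff)
  qed

  have inner_lower: "\<mu> * e n - K / (real n + \<nu>) * (1 + e n) \<le> (\<integral>\<omega>. inner (d n \<omega>) (X n \<omega>) \<partial>P)"
    if n: "n \<ge> 1" for n
  proof -
    define k where "k = K / (real n + \<nu>)"
    have k: "k \<ge> 0" using pos by (simp add: k_def)
    have r_bound: "AE \<omega> in P. norm (r n \<omega>) \<le> k"
      using esssup_AE[of "\<lambda>\<omega>. ereal (norm (r n \<omega>))" P]
    proof eventually_elim
      case (elim \<omega>)
      then show ?case using bias_decay[OF n] unfolding bias_def k_def
        by (meson ereal_less_eq(3) order_trans)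
    qed
    have "AE \<omega> in P. \<mu> * (norm (d n \<omega>))\<^sup>2 - k * (1 + (norm (d n \<omega>))\<^sup>2) \<le> inner (d n \<omega>) (EG n \<omega>)"
      using r_bound AE_space
    proof eventually_elim
      case (elim \<omega>)
      have "\<mu> * (norm (d n \<omega>))\<^sup>2 \<le> inner (d n \<omega>) (gradj (u n \<omega>))"
        unfolding d_def using V(2) ustar_Uad
        by (intro strong_monotone_at_minimizer[OF Uad(3) ustar gradj strong_convexity u_Uad[OF n elim(2)]]) auto
      moreover have "- (k * (1 + (norm (d n \<omega>))\<^sup>2)) \<le> inner (d n \<omega>) (r n \<omega>)"
      proof -
        have "norm (d n \<omega>) \<le> 1 + (norm (d n \<omega>))\<^sup>2"
          \<comment> \<open>The difference of the two sides is \<open>(x - 1 / 2)\<^sup>2 + 3 / 4\<close>.\<close>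
          using zero_le_power2[of "norm (d n \<omega>) - 1 / 2"] by (simp add: power2_eq_square algebra_simps)
        then have "norm (d n \<omega>) * norm (r n \<omega>) \<le> (1 + (norm (d n \<omega>))\<^sup>2) * k"
          using elim(1) by (intro mult_mono) auto
        then show ?thesis
          using Cauchy_Schwarz_ineq2[of "d n \<omega>" "r n \<omega>"] by (simp add: mult.commute abs_le_iff)
      qed
      moreover have "EG n \<omega> = gradj (u n \<omega>) + r n \<omega>" by (simp add: r_def)
      ultimately show ?case by (simp add: inner_add_right)
    qed
    then have "(\<integral>\<omega>. \<mu> * (norm (d n \<omega>))\<^sup>2 - k * (1 + (norm (d n \<omega>))\<^sup>2) \<partial>P)
        \<le> (\<integral>\<omega>. inner (d n \<omega>) (EG n \<omega>) \<partial>P)"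
      using is_cond_exp_inner(2)[OF ce[OF n] d_adapted[OF n] d_bound[OF n]] d_int(2)[OF n]
      by (intro integral_mono_AE) auto
    also have "\<dots> = (\<integral>\<omega>. inner (d n \<omega>) (X n \<omega>) \<partial>P)"
      using is_cond_exp_inner(3)[OF ce[OF n] d_adapted[OF n] d_bound[OF n]] by simp
    finally show ?thesis
      using d_int(2)[OF n] by (simp add: e_def k_def prob_space)
  qed

  have step: "e (Suc n) \<le> e n * (1 - 2 * \<mu> * \<theta> / (real n + \<nu>) + 2 * \<theta> * K / (real n + \<nu>)\<^sup>2)
      + (\<theta>\<^sup>2 * M + 2 * \<theta> * K) / (real n + \<nu>)\<^sup>2" if n: "n \<ge> 1" for n
  proof -
    define N where "N = real n + \<nu>"
    have N: "N > 0" using pos by (simp add: N_def)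
    have t_n: "t n = \<theta> / N" using t[OF n] by (simp add: N_def)
    note inner_int = is_cond_exp_inner(1)[OF ce[OF n] d_adapted[OF n] d_bound[OF n]]
    have "e (Suc n) \<le> (\<integral>\<omega>. (norm (d n \<omega>))\<^sup>2 - 2 * t n * inner (d n \<omega>) (X n \<omega>) + (t n)\<^sup>2 * (norm (X n \<omega>))\<^sup>2 \<partial>P)"
      unfolding e_def
    proof (rule integral_mono)
      fix \<omega> assume \<omega>: "\<omega> \<in> space P"
      have "norm (d (Suc n) \<omega>) \<le> norm (d n \<omega> - t n *\<^sub>R X n \<omega>)"
        using metric_proj_nonexpansive[OF proj, of "u n \<omega> - t n *\<^sub>R X n \<omega>" ustar]
        by (simp add: d_def X_def iteration[OF n \<omega>] metric_proj_fixes[OF proj ustar_Uad] algebra_simps)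
      then have "(norm (d (Suc n) \<omega>))\<^sup>2 \<le> (norm (d n \<omega> - t n *\<^sub>R X n \<omega>))\<^sup>2"
        by (rule power_mono) simp
      also have "\<dots> = (norm (d n \<omega>))\<^sup>2 - 2 * t n * inner (d n \<omega>) (X n \<omega>) + (t n)\<^sup>2 * (norm (X n \<omega>))\<^sup>2"
        unfolding power2_norm_eq_inner
        by (simp add: inner_diff_left inner_diff_right inner_commute power2_eq_square algebra_simps)
      finally show "(norm (d (Suc n) \<omega>))\<^sup>2
        \<le> (norm (d n \<omega>))\<^sup>2 - 2 * t n * inner (d n \<omega>) (X n \<omega>) + (t n)\<^sup>2 * (norm (X n \<omega>))\<^sup>2" .
    qed (use d_int(2) n inner_int X_second_moment(1)[OF n] in auto)
    also have "\<dots> = e n - 2 * t n * (\<integral>\<omega>. inner (d n \<omega>) (X n \<omega>) \<partial>P) + (t n)\<^sup>2 * (\<integral>\<omega>. (norm (X n \<omega>))\<^sup>2 \<partial>P)"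
      using d_int(2)[OF n] inner_int X_second_moment(1)[OF n] by (simp add: e_def)
    also have "\<dots> \<le> e n - 2 * t n * (\<mu> * e n - K / N * (1 + e n)) + (t n)\<^sup>2 * M"
      using inner_lower[OF n] X_second_moment(2)[OF n] N pos
      by (intro add_mono diff_left_mono mult_left_mono) (auto simp: t_n N_def)
    also have "\<dots> = e n * (1 - 2 * \<mu> * \<theta> / N + 2 * \<theta> * K / N\<^sup>2) + (\<theta>\<^sup>2 * M + 2 * \<theta> * K) / N\<^sup>2"
      using N by (simp add: t_n field_simps power2_eq_square)
    finally show ?thesis by (simp add: N_def)
  qed

  \<comment> \<open>The bound on \<open>\<nu>\<close> says that the denominator in \<open>\<rho>\<close> is nonpositive; being nonzero, it is negative.\<close>
  have den: "(1 + \<nu>) * (1 - 2 * \<mu> * \<theta>) + 2 * \<theta> * K < 0"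
  proof -
    have "2 * \<mu> * \<theta> - 1 > 0" using theta pos by (simp add: field_simps)
    moreover have "2 * \<theta> * K / (2 * \<mu> * \<theta> - 1) \<le> 1 + \<nu>" using nu by simp
    ultimately have "2 * \<theta> * K \<le> (1 + \<nu>) * (2 * \<mu> * \<theta> - 1)" by (simp add: pos_divide_le_eq)
    then show ?thesis using denominator by (simp add: algebra_simps)
  qed
  have e_le: "e n \<le> \<rho> / (real n + \<nu>)" if "n \<ge> 1" for n
  proof (rule harmonic_step_recursion[OF pos(1-3) _ _ den _ _ step that])
    show "0 \<le> \<theta>\<^sup>2 * M + 2 * \<theta> * K" using pos M_pos by simp
    show "0 \<le> e n" for n by (simp add: e_def)
    show "\<rho> = max ((1 + \<nu>) * e 1) (- (\<theta>\<^sup>2 * M + 2 * \<theta> * K) * (1 + \<nu>)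
        / ((1 + \<nu>) * (1 - 2 * \<mu> * \<theta>) + 2 * \<theta> * K))"
      by (simp add: \<rho>_def e_def d_def)
    show "0 \<le> 1 - 2 * \<mu> * \<theta> / (real n + \<nu>) + 2 * \<theta> * K / (real n + \<nu>)\<^sup>2" if "n \<ge> 1" for n
      using factor_nonneg[OF that] by (simp add: t[OF that] power2_eq_square)
  qed

  show ?thesis
  proof (intro conjI allI impI)
    fix n :: nat assume n: "n \<ge> 1"
    show "integrable P (\<lambda>\<omega>. norm (u n \<omega> - ustar))" using d_int(1)[OF n] by (simp add: d_def)
    \<comment> \<open>Jensen's inequality, in the form that a variance is nonnegative.\<close>
    have "(\<integral>\<omega>. norm (d n \<omega>) \<partial>P)\<^sup>2 \<le> e n"
      using variance_positive[of "\<lambda>\<omega>. norm (d n \<omega>)"] variance_eq[OF d_int[OF n]] by (simp add: e_def)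
    then have "(\<integral>\<omega>. norm (d n \<omega>) \<partial>P) \<le> sqrt (\<rho> / (real n + \<nu>))"
      using e_le[OF n] by (intro real_le_rsqrt) simp
    then show "(\<integral>\<omega>. norm (u n \<omega> - ustar) \<partial>P) \<le> sqrt (\<rho> / (real n + \<nu>))" by (simp add: d_def)
  next
    fix L :: real and n :: nat
    assume "L > 0" and L: "L-lipschitz_on Uad gradj \<and> gradj ustar = 0" and n: "n \<ge> 1"
    have grad: "GDERIV j v :> gradj v" if "v \<in> Uad" for v using gradj that V(2) by blast
    have gap: "0 \<le> j v - j ustar" "j v - j ustar \<le> L / 2 * (norm (v - ustar))\<^sup>2" if "v \<in> Uad" for v
      using ustar that lipschitz_gradient_quadratic_bound[OF Uad(3) ustar_Uad that grad] L
      by (auto simp: is_arg_min_linorder)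
    have "continuous_on Uad j"
    proof (rule continuous_at_imp_continuous_on, safe)
      show "isCont j v" if "v \<in> Uad" for v
        using grad[OF that] unfolding gderiv_def by (rule has_derivative_continuous)
    qed
    then have "j \<in> borel_measurable (restrict_space borel Uad)"
      by (rule borel_measurable_continuous_on_restrict)
    moreover have "u n \<in> measurable P (restrict_space borel Uad)"
      using u_strong[OF n] u_Uad[OF n] by (intro measurable_restrict_space2) (auto simp: strongly_measurable_def)
    ultimately have "(\<lambda>\<omega>. j (u n \<omega>)) \<in> borel_measurable P" by (rule measurable_compose[rotated])
    then have gap_meas: "(\<lambda>\<omega>. j (u n \<omega>) - j ustar) \<in> borel_measurable P" by simp
    have dom: "integrable P (\<lambda>\<omega>. L / 2 * (norm (d n \<omega>))\<^sup>2)" using d_int(2)[OF n] by simp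
    show int: "integrable P (\<lambda>\<omega>. j (u n \<omega>) - j ustar)"
      using gap u_Uad[OF n]
      by (intro Bochner_Integration.integrable_bound[OF dom gap_meas] AE_I2) (fastforce simp: d_def)
    have "(\<integral>\<omega>. (j (u n \<omega>) - j ustar) \<partial>P) \<le> (\<integral>\<omega>. L / 2 * (norm (d n \<omega>))\<^sup>2 \<partial>P)"
      using gap(2) u_Uad[OF n] by (intro integral_mono int dom) (auto simp: d_def)
    also have "\<dots> = L / 2 * e n" by (simp add: e_def)
    also have "\<dots> \<le> L / 2 * (\<rho> / (real n + \<nu>))"
      using e_le[OF n] \<open>L > 0\<close> by (intro mult_left_mono) auto
    finally show "(\<integral>\<omega>. (j (u n \<omega>) - j ustar) \<partial>P) \<le> L * \<rho> / (2 * (real n + \<nu>))"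
      by simp
  qed
qed

end
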